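(* Let $S$ be a Polish space with Borel $\sigma$-field $\mathcal{B}$, let $\lambda$ be a $\sigma$-finite measure on $\mathcal{B}$, and let $X=(X_1,X_2,\ldots)$ be a conditionally identically distributed (c.i.d.) sequence of $S$-valued random variables on a probability space $(\Omega,\mathcal{A},P)$. Let $\alpha_n$ ($n\ge 0$) be the predictive measures of $X$ and let $\alpha$ be the random probability measure on $S$ with $\alpha_n\to\alpha$ weakly a.s. Then $\alpha(\omega)\ll\lambda$ for $P$-almost all $\omega\in\Omega$ if and only if both of the following hold: $\Vert\alpha_n-\alpha\Vert\to 0$ a.s. as $n\to\infty$, and $\mathcal{L}(X_1,\ldots,X_n)\ll\lambda^n$ for all $n\geq 1$.
   Context: Let $\mathbb{S}$ be the set of probability measures on $\mathcal{B}$. A random probability measure on $S$ is a map $\alpha:\Omega\to\mathbb{S}$ such that $\omega\mapsto\alpha(\omega)(B)$ is $\mathcal{A}$-measurable for every $B\in\mathcal{B}$; $\sigma(\alpha)$ is the $\sigma$-field on $\Omega$ generated by these maps. The sequence $X$ is conditionally identically distributed (c.i.d.) if $(X_1,\ldots,X_n,X_{n+2})$ and $(X_1,\ldots,X_n,X_{n+1})$ have the same distribution for every $n\geq 0$ (for $n=0$: $X_2\sim X_1$). Let $\mathcal{G}_0=\{\varnothing,\Omega\}$, $\mathcal{G}_n=\sigma(X_1,\ldots,X_n)$ for $n\ge1$, $\mathcal{G}_\infty=\sigma(\bigcup_n\mathcal{G}_n)$. For $n\geq1$ the $n$th predictive measure $\alpha_n$ is a random probability measure on $S$ such that, for every $B\in\mathcal{B}$,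 $\alpha_n(\cdot)(B)$ is a version of $P(X_{n+1}\in B\mid X_1,\ldots,X_n)$; also $\alpha_0(\cdot)=P(X_1\in\cdot)$. Known fact (background): if $X$ is c.i.d., there is a random probability measure $\alpha$ on $S$ such that $\sigma(\alpha)\subset\mathcal{G}_\infty$ and, for every $B\in\mathcal{B}$ and $n\ge 0$, $\alpha_n(B)=E\{\alpha(B)\mid\mathcal{G}_n\}$ a.s.; in particular $\alpha_n(\omega)\to\alpha(\omega)$ weakly for almost all $\omega$, so $\alpha$ is determined up to a $P$-null set. This is the $\alpha$ in the claim (with $\sigma(\alpha)\subset\mathcal{G}_\infty$). $\Vert\cdot\Vert$ is total variation norm on $(S,\mathcal{B})$: $\Vert\mu-\nu\Vert=\sup_{B\in\mathcal{B}}|\mu(B)-\nu(B)|$ for $\mu,\nu\in\mathbb{S}$. $\mathcal{L}(\cdot)$ denotes probability distribution under $P$, and $\lambda^n=\lambda\times\cdots\times\lambda$ ($n$ factors). *)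

theory Defs
  imports "HOL-Probability.Probability"
begin

text \<open>
  Sequences are indexed from 0: \<open>X i\<close> is the random variable $X_{i+1}$, so that
  \<open>X 0, \<dots>, X (n - 1)\<close> are the first \<open>n\<close> observations. The measure-valued sequence \<open>\<alpha>\<close>
  keeps its usual index: \<open>\<alpha> n\<close> is the conditional law of \<open>X n\<close> given the first \<open>n\<close>
  observations.
\<close>

definition joint_law ::
  "'w measure \<Rightarrow> (nat \<Rightarrow> 'w \<Rightarrow> 'a::topological_space) \<Rightarrow> nat \<Rightarrow> (nat \<Rightarrow> 'a) measure" where
  "joint_law M X n =
     distr M (\<Pi>\<^sub>M i\<in>{..<n}. borel) (\<lambda>\<omega>. \<lambda>i\<in>{..<n}. X i \<omega>)"

text \<open>The sequence on the left is $(X_1, \ldots, X_n, X_{n+2})$.\<close>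

definition cid :: "'w measure \<Rightarrow> (nat \<Rightarrow> 'w \<Rightarrow> 'a::topological_space) \<Rightarrow> bool" where
  "cid M X \<longleftrightarrow> (\<forall>n. joint_law M (X(n := X (Suc n))) (Suc n) = joint_law M X (Suc n))"

definition past :: "'w measure \<Rightarrow> (nat \<Rightarrow> 'w \<Rightarrow> 'a::topological_space) \<Rightarrow> nat \<Rightarrow> 'w measure" where
  "past M X n = sigma (space M) (\<Union>i<n. {X i -` B \<inter> space M | B. B \<in> sets borel})"

definition past_infinity :: "'w measure \<Rightarrow> (nat \<Rightarrow> 'w \<Rightarrow> 'a::topological_space) \<Rightarrow> 'w measure" where
  "past_infinity M X = sigma (space M) (\<Union>n. sets (past M X n))"

text \<open>
  The \<open>\<sigma>\<close>-field of \<open>prob_algebra borel\<close> is the one generated by the evaluation maps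
  \<open>\<mu> \<mapsto> \<mu> B\<close> for Borel \<open>B\<close>, so this says that \<open>\<alpha> \<omega>\<close> is a Borel probability measure
  for \<open>\<omega> \<in> space M\<close> and that \<open>\<omega> \<mapsto> \<alpha> \<omega> B\<close> is measurable for every Borel \<open>B\<close>.
\<close>

definition random_prob_measure ::
  "'w measure \<Rightarrow> ('w \<Rightarrow> 'a::topological_space measure) \<Rightarrow> bool" where
  "random_prob_measure M \<alpha> \<longleftrightarrow> \<alpha> \<in> M \<rightarrow>\<^sub>M prob_algebra borel"

definition sigma_of_random_measure ::
  "'w measure \<Rightarrow> ('w \<Rightarrow> 'a::topological_space measure) \<Rightarrow> 'w measure" where
  "sigma_of_random_measure M \<alpha> = vimage_algebra (space M) \<alpha> (prob_algebra borel)"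

definition cond_prob_version ::
  "'w measure \<Rightarrow> 'w measure \<Rightarrow> 'w set \<Rightarrow> ('w \<Rightarrow> real) \<Rightarrow> bool" where
  "cond_prob_version M F A g \<longleftrightarrow>
     g \<in> borel_measurable F \<and> (AE \<omega> in M. g \<omega> = real_cond_exp M F (indicator A) \<omega>)"

definition predictive_measures ::
  "'w measure \<Rightarrow> (nat \<Rightarrow> 'w \<Rightarrow> 'a::topological_space) \<Rightarrow> (nat \<Rightarrow> 'w \<Rightarrow> 'a measure) \<Rightarrow> bool" where
  "predictive_measures M X \<alpha> \<longleftrightarrow>
     (\<forall>\<omega>\<in>space M. \<alpha> 0 \<omega> = distr M borel (X 0)) \<and>
     (\<forall>n\<ge>1. random_prob_measure M (\<alpha> n) \<and>
       (\<forall>B\<in>sets borel.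
          cond_prob_version M (past M X n) (X n -` B \<inter> space M) (\<lambda>\<omega>. measure (\<alpha> n \<omega>) B)))"

text \<open>The library's \<open>weak_conv_m\<close> covers only measures on the real line.\<close>

definition weakly_converges ::
  "(nat \<Rightarrow> 'a::topological_space measure) \<Rightarrow> 'a measure \<Rightarrow> bool" where
  "weakly_converges \<mu> \<nu> \<longleftrightarrow>
     (\<forall>f :: 'a \<Rightarrow> real. continuous_on UNIV f \<and> bounded (range f) \<longrightarrow>
        (\<lambda>n. \<integral>x. f x \<partial>\<mu> n) \<longlonglongrightarrow> (\<integral>x. f x \<partial>\<nu>))"

definition tv_dist :: "'a::topological_space measure \<Rightarrow> 'a measure \<Rightarrow> real" where
  "tv_dist \<mu> \<nu> = (SUP B\<in>sets borel. \<bar>measure \<mu> B - measure \<nu> B\<bar>)"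

end

theory Submission imports Defs begin

text \<open>
  The c.i.d. property and weak convergence give $P(A, X_{n+1} \in B) = E(1_A\,\alpha(B))$ for
  $A \in \mathcal{G}_n$, so that $\alpha_n(B) = E(\alpha(B) \mid \mathcal{G}_n)$.

  If $\alpha \ll \lambda$ a.s., this identity and Fubini yield
  $\mathcal{L}(X_1, \dots, X_n) \ll \lambda^n$ by induction on $n$. For the convergence one may take
  $\lambda$ finite. Then $\alpha$ has a jointly measurable density
  $f \in L^1(\mathcal{G}_\infty \otimes \mathcal{B}, P \times \lambda)$, which is approximated in
  $L^1$ by some $\mathcal{G}_m \otimes \mathcal{B}$-measurable $h$. With
  $Y = \int |f - h| \, d\lambda$ one gets
  $\Vert\alpha_n - \alpha\Vert \le E(Y \mid \mathcal{G}_n) + Y$ for all $n \ge m$, and the maximal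
  inequality bounds the supremum over $n$ in probability by $E(Y)$.

  Conversely, absolute continuity of the joint laws gives $\alpha_n \ll \lambda$ a.s., which
  survives limits in total variation.
\<close>

section \<open>Total variation, filtrations and the maximal inequality\<close>

text \<open>Conditional identities hold almost surely for one Borel set at a time, whereas absolute
  continuity and total variation concern uncountably many sets at once. Two devices bridge this gap.
  A countable class of open sets that controls the distance of finite measures leaves a single
  exceptional null set. And identities on rectangles A x B are extended to all measurable subsets of
  \<Omega> x S, so that they apply to sets whose section in S moves with \<omega>, such as a subset
  of the (n+1)-fold product with the first n observations inserted.

  The density of \<alpha> has to be G_infinity-measurable in \<omega>, since the approximating h
  must depend on finitely many observations; this is where the hypothesis on sigma(\<alpha>) enters.
  The integral b of h over B is then fixed by conditioning on G_n for n >= m. Hence \<alpha>(B) and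
  \<alpha>_n(B) = E(\<alpha>(B) | G_n) both lie near b, with errors Y and E(Y | G_n) that do not
  depend on B.\<close>

lemma outer_approx_open:
  fixes N :: "'b::polish_space measure"
  assumes "sets N = sets borel" "finite_measure N" "B \<in> sets borel" "e > 0"
  obtains U where "open U" "B \<subseteq> U" "measure N U \<le> measure N B + e"
proof -
  interpret N: finite_measure N by fact
  have "emeasure N B < emeasure N B + ennreal e"
    using assms(4) by (simp add: N.emeasure_eq_measure ennreal_less_iff flip: ennreal_plus)
  moreover have "emeasure N B = (INF U \<in> {U. B \<subseteq> U \<and> open U}. emeasure N U)"
    using assms by (intro outer_regular) auto
  ultimately obtain U where U: "B \<subseteq> U" "open U" "emeasure N U < emeasure N B + ennreal e"
    by (auto simp: INF_less_iff)
  then have "measure N U \<le> measure N B + e"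
    using assms(4) by (simp add: N.emeasure_eq_measure ennreal_less_iff flip: ennreal_plus)
  with U that show ?thesis by blast
qed

text \<open>The bound passes to all Borel sets with the same r, so a countable class of this kind
  controls total variation without loss. The case r = 0 is a uniqueness criterion for finite
  measures.\<close>

definition distance_determining :: "'b::topological_space set set \<Rightarrow> bool" where
  "distance_determining K \<longleftrightarrow> (\<forall>\<mu> \<nu> r.
     sets \<mu> = sets borel \<and> sets \<nu> = sets borel \<and> finite_measure \<mu> \<and> finite_measure \<nu> \<and>
     (\<forall>C\<in>K. \<bar>measure \<mu> C - measure \<nu> C\<bar> \<le> r) \<longrightarrow>
     (\<forall>B\<in>sets borel. \<bar>measure \<mu> B - measure \<nu> B\<bar> \<le> r))"

lemma distance_determiningD:
  assumes "distance_determining K" "sets \<mu> = sets borel" "sets \<nu> = sets borel"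
    "finite_measure \<mu>" "finite_measure \<nu>" "\<And>C. C \<in> K \<Longrightarrow> \<bar>measure \<mu> C - measure \<nu> C\<bar> \<le> r" "B \<in> sets borel"
  shows "\<bar>measure \<mu> B - measure \<nu> B\<bar> \<le> r"
  using assms(1)[unfolded distance_determining_def, rule_format, of \<mu> \<nu> r B] assms(2-) by simp

lemma finite_measure_eqI_determining:
  assumes K: "distance_determining K" and sets: "sets \<mu> = sets borel" "sets \<nu> = sets borel"
    and fin: "finite_measure \<mu>" "finite_measure \<nu>" and eq: "\<And>C. C \<in> K \<Longrightarrow> emeasure \<mu> C = emeasure \<nu> C"
  shows "\<mu> = \<nu>"
proof (rule measure_eqI)
  fix B assume "B \<in> sets \<mu>"
  then have B: "B \<in> sets borel" by (simp add: sets)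
  have "\<bar>measure \<mu> C - measure \<nu> C\<bar> \<le> 0" if "C \<in> K" for C
    unfolding measure_def eq[OF that] by simp
  then have "\<bar>measure \<mu> B - measure \<nu> B\<bar> \<le> 0"
    using B by (rule distance_determiningD[OF K sets fin])
  then show "emeasure \<mu> B = emeasure \<nu> B"
    by (simp add: finite_measure.emeasure_eq_measure[OF fin(1)] finite_measure.emeasure_eq_measure[OF fin(2)])
qed (simp add: sets)

text \<open>Finite unions of basic open sets: they exhaust the open sets from below, and finite Borel
  measures are outer regular.\<close>

lemma ex_countable_distance_determining:
  "\<exists>K :: 'b::polish_space set set. countable K \<and> (\<forall>C\<in>K. open C) \<and> distance_determining K"
proof -
  obtain Bs :: "'b set set" where Bs: "countable Bs" "topological_basis Bs"
    using ex_countable_basis by auto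
  define K where "K = Union ` {F. finite F \<and> F \<subseteq> Bs}"
  have cK: "countable K"
    unfolding K_def using countable_Collect_finite_subset[OF Bs(1)] by simp
  have oK: "open C" if "C \<in> K" for C
    using that topological_basis_open[OF Bs(2)] unfolding K_def by auto
  have main: "\<bar>measure \<mu> B - measure \<nu> B\<bar> \<le> r"
    if sets: "sets \<mu> = sets borel" "sets \<nu> = sets borel" and fin: "finite_measure \<mu>" "finite_measure \<nu>"
      and le: "\<And>C. C \<in> K \<Longrightarrow> \<bar>measure \<mu> C - measure \<nu> C\<bar> \<le> r" and B: "B \<in> sets borel"
    for \<mu> \<nu> :: "'b measure" and r B
  proof -
    interpret \<mu>: finite_measure \<mu> by fact
    interpret \<nu>: finite_measure \<nu> by fact
    have opn: "\<bar>measure \<mu> U - measure \<nu> U\<bar> \<le> r" if "open U" for U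
    proof -
      obtain C where C: "C \<subseteq> Bs" "\<Union>C = U"
        using Bs(2) \<open>open U\<close> unfolding topological_basis_def by blast
      show ?thesis
      proof (cases "C = {}")
        case True
        then have "U \<in> K" using C unfolding K_def by auto
        then show ?thesis by (rule le)
      next
        case False
        have cC: "countable C" using C(1) Bs(1) countable_subset by blast
        define A where "A n = (\<Union>i<n. from_nat_into C i)" for n :: nat
        have AK: "A n \<in> K" for n
        proof -
          have "A n = \<Union>(from_nat_into C ` {..<n})" unfolding A_def by auto
          moreover have "from_nat_into C ` {..<n} \<subseteq> Bs"
            using from_nat_into[OF False] C(1) by auto
          ultimately show ?thesis unfolding K_def by auto
        qed
        have UA: "(\<Union>n. A n) = U"
        proof -
          have "(\<Union>n. A n) = (\<Union>i. from_nat_into C i)" unfolding A_def by auto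
          also have "\<dots> = U" using range_from_nat_into[OF False cC] C(2) by simp
          finally show ?thesis .
        qed
        have inc: "incseq A" unfolding A_def incseq_def by (auto intro: less_le_trans)
        have rng: "range A \<subseteq> sets borel" using oK[OF AK] by auto
        have "(\<lambda>n. measure \<mu> (A n)) \<longlonglongrightarrow> measure \<mu> U"
          using \<mu>.finite_Lim_measure_incseq[of A] rng inc UA sets by auto
        moreover have "(\<lambda>n. measure \<nu> (A n)) \<longlonglongrightarrow> measure \<nu> U"
          using \<nu>.finite_Lim_measure_incseq[of A] rng inc UA sets by auto
        ultimately have "(\<lambda>n. \<bar>measure \<mu> (A n) - measure \<nu> (A n)\<bar>) \<longlonglongrightarrow> \<bar>measure \<mu> U - measure \<nu> U\<bar>"
          by (intro tendsto_intros)
        then show ?thesis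
          by (rule LIMSEQ_le_const2) (use le AK in auto)
      qed
    qed
    have "\<bar>measure \<mu> B - measure \<nu> B\<bar> \<le> r + e" if "e > 0" for e
    proof -
      obtain U where U: "open U" "B \<subseteq> U" "measure \<mu> U \<le> measure \<mu> B + e"
        using outer_approx_open[of \<mu> B e] sets fin B \<open>e > 0\<close> by blast
      obtain V where V: "open V" "B \<subseteq> V" "measure \<nu> V \<le> measure \<nu> B + e"
        using outer_approx_open[of \<nu> B e] sets fin B \<open>e > 0\<close> by blast
      \<comment> \<open>The intersection serves both measures at once. Each measure of
        \<open>?W\<close> exceeds that of B by an amount in [0, e], so the difference of the two
        changes by at most e rather than 2 e.\<close>
      let ?W = "U \<inter> V"
      have "measure \<mu> ?W \<le> measure \<mu> U" "measure \<nu> ?W \<le> measure \<nu> V"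
        "measure \<mu> B \<le> measure \<mu> ?W" "measure \<nu> B \<le> measure \<nu> ?W"
        using U V sets B by (auto intro!: \<mu>.finite_measure_mono \<nu>.finite_measure_mono)
      moreover have "\<bar>measure \<mu> ?W - measure \<nu> ?W\<bar> \<le> r" using U V by (intro opn) auto
      ultimately show ?thesis using U(3) V(3) by linarith
    qed
    then show ?thesis by (rule field_le_epsilon)
  qed
  have "distance_determining K" unfolding distance_determining_def by (intro allI impI ballI, elim conjE, rule main) auto
  with cK oK show ?thesis by blast
qed

section \<open>Approximation in mean by functions of a finite stage, and Doob's maximal
  inequality\<close>

text \<open>The approximable functions are closed under linear combinations and dominated limits,
  and the union of the nested stages is stable under intersection. Dynkin induction therefore
  reaches the indicator of every set of the generated sigma-field, and from there all integrable
  functions.\<close>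

lemma L1_dense_filtration:
  fixes Q :: "'b measure" and F :: "nat \<Rightarrow> 'b measure" and f :: "'b \<Rightarrow> real"
  assumes "finite_measure Q"
    and sub: "\<And>m. subalgebra Q (F m)"
    and mono: "\<And>m n. m \<le> n \<Longrightarrow> sets (F m) \<subseteq> sets (F n)"
    and gen: "sets Q = sigma_sets (space Q) (\<Union>m. sets (F m))"
    and f: "integrable Q f" and "e > 0"
  obtains m h where "h \<in> borel_measurable (F m)" "integrable Q h" "(\<integral>x. \<bar>f x - h x\<bar> \<partial>Q) < e"
proof -
  interpret finite_measure Q by fact
  have sp: "space (F m) = space Q" for m using sub unfolding subalgebra_def by auto
  have subF: "subalgebra (F n) (F m)" if "m \<le> n" for m n
    using mono[OF that] sp unfolding subalgebra_def by auto
  define P where "P g \<longleftrightarrow> (\<forall>e>0. \<exists>m h. h \<in> borel_measurable (F m) \<and> integrable Q h \<and>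
      (\<integral>x. \<bar>g x - h x\<bar> \<partial>Q) < e)" for g :: "'b \<Rightarrow> real"
  have P_self: "P g" if "g \<in> borel_measurable (F m)" "integrable Q g" for g m
    unfolding P_def using that by (intro allI impI exI[of _ m] exI[of _ g]) auto
  have P_close: "P g" if g: "integrable Q g"
    and ex: "\<And>d. d > 0 \<Longrightarrow> \<exists>k. P k \<and> integrable Q k \<and> (\<integral>x. \<bar>g x - k x\<bar> \<partial>Q) < d" for g
    unfolding P_def
  proof (intro allI impI)
    fix e :: real assume "e > 0"
    then obtain k where k: "P k" "integrable Q k" "(\<integral>x. \<bar>g x - k x\<bar> \<partial>Q) < e/2"
      using ex[of "e/2"] by auto
    from k(1) \<open>e > 0\<close> obtain m h where h: "h \<in> borel_measurable (F m)" "integrable Q h"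
      "(\<integral>x. \<bar>k x - h x\<bar> \<partial>Q) < e/2"
      unfolding P_def by (meson half_gt_zero)
    have "(\<integral>x. \<bar>g x - h x\<bar> \<partial>Q) \<le> (\<integral>x. \<bar>g x - k x\<bar> + \<bar>k x - h x\<bar> \<partial>Q)"
      using g k(2) h(2) by (intro integral_mono) auto
    also have "\<dots> < e" using g k h by (subst Bochner_Integration.integral_add) auto
    finally show "\<exists>m h. h \<in> borel_measurable (F m) \<and> integrable Q h \<and> (\<integral>x. \<bar>g x - h x\<bar> \<partial>Q) < e"
      using h by blast
  qed
  have P_lim: "P g" if g: "integrable Q g" and s: "\<And>i. integrable Q (s i)" "\<And>i. P (s i)"
    and lim: "\<And>x. x \<in> space Q \<Longrightarrow> (\<lambda>i. s i x) \<longlonglongrightarrow> g x"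
    and dom: "\<And>i x. x \<in> space Q \<Longrightarrow> \<bar>s i x\<bar> \<le> w x" and w: "integrable Q w" for g s and w :: "'b \<Rightarrow> real"
  proof (rule P_close[OF g])
    fix d :: real assume "d > 0"
    have "(\<lambda>i. \<integral>x. \<bar>g x - s i x\<bar> \<partial>Q) \<longlonglongrightarrow> (\<integral>x. 0 \<partial>Q)"
    proof (rule integral_dominated_convergence[where w = "\<lambda>x. \<bar>g x\<bar> + w x"])
      show "AE x in Q. (\<lambda>i. \<bar>g x - s i x\<bar>) \<longlonglongrightarrow> 0"
      proof (rule AE_I2)
        fix x assume "x \<in> space Q"
        then have "(\<lambda>i. \<bar>g x - s i x\<bar>) \<longlonglongrightarrow> \<bar>g x - g x\<bar>" by (intro tendsto_intros lim)
        then show "(\<lambda>i. \<bar>g x - s i x\<bar>) \<longlonglongrightarrow> 0" by simp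
      qed
      show "AE x in Q. norm \<bar>g x - s i x\<bar> \<le> \<bar>g x\<bar> + w x" for i
        using dom[of _ i] by (intro AE_I2) (smt (verit) real_norm_def)
    qed (use g s(1) w in auto)
    then have "eventually (\<lambda>i. (\<integral>x. \<bar>g x - s i x\<bar> \<partial>Q) < d) sequentially"
      using \<open>d > 0\<close> by (intro order_tendstoD) auto
    then obtain i where "(\<integral>x. \<bar>g x - s i x\<bar> \<partial>Q) < d" by (auto simp: eventually_sequentially)
    then show "\<exists>k. P k \<and> integrable Q k \<and> (\<integral>x. \<bar>g x - k x\<bar> \<partial>Q) < d"
      using s by blast
  qed
  have P_add: "P (\<lambda>x. g x + k x)" if gk: "integrable Q g" "P g" "integrable Q k" "P k" for g k
    unfolding P_def
  proof (intro allI impI)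
    fix e :: real assume "e > 0"
    then obtain m1 h1 where h1: "h1 \<in> borel_measurable (F m1)" "integrable Q h1"
      "(\<integral>x. \<bar>g x - h1 x\<bar> \<partial>Q) < e/2" using gk(2) unfolding P_def by (meson half_gt_zero)
    obtain m2 h2 where h2: "h2 \<in> borel_measurable (F m2)" "integrable Q h2"
      "(\<integral>x. \<bar>k x - h2 x\<bar> \<partial>Q) < e/2" using \<open>e > 0\<close> gk(4) unfolding P_def by (meson half_gt_zero)
    have [measurable]: "h1 \<in> borel_measurable (F (max m1 m2))" "h2 \<in> borel_measurable (F (max m1 m2))"
      using measurable_from_subalg[OF subF h1(1)] measurable_from_subalg[OF subF h2(1)] by auto
    have "(\<integral>x. \<bar>g x + k x - (h1 x + h2 x)\<bar> \<partial>Q) \<le> (\<integral>x. \<bar>g x - h1 x\<bar> + \<bar>k x - h2 x\<bar> \<partial>Q)"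
      using gk h1(2) h2(2) by (intro integral_mono) auto
    also have "\<dots> < e" using gk h1 h2 by (subst Bochner_Integration.integral_add) auto
    finally show "\<exists>m h. h \<in> borel_measurable (F m) \<and> integrable Q h \<and> (\<integral>x. \<bar>g x + k x - h x\<bar> \<partial>Q) < e"
      using h1(2) h2(2) by (intro exI[of _ "max m1 m2"] exI[of _ "\<lambda>x. h1 x + h2 x"]) auto
  qed
  have P_cmult: "P (\<lambda>x. c * g x)" if g: "integrable Q g" "P g" for g and c :: real
    unfolding P_def
  proof (intro allI impI)
    fix e :: real assume "e > 0"
    then have "e / (\<bar>c\<bar> + 1) > 0" by auto
    then obtain m h where h: "h \<in> borel_measurable (F m)" "integrable Q h"
      "(\<integral>x. \<bar>g x - h x\<bar> \<partial>Q) < e / (\<bar>c\<bar> + 1)" using g(2) unfolding P_def by meson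
    have "(\<integral>x. \<bar>c * g x - c * h x\<bar> \<partial>Q) = \<bar>c\<bar> * (\<integral>x. \<bar>g x - h x\<bar> \<partial>Q)"
      by (subst integral_mult_right_zero[symmetric])
        (simp add: abs_mult flip: right_diff_distrib)
    also have "\<dots> \<le> (\<bar>c\<bar> + 1) * (\<integral>x. \<bar>g x - h x\<bar> \<partial>Q)"
      by (intro mult_right_mono) auto
    also have "\<dots> < e" using h(3) by (simp add: field_simps)
    finally show "\<exists>m h. h \<in> borel_measurable (F m) \<and> integrable Q h \<and> (\<integral>x. \<bar>c * g x - h x\<bar> \<partial>Q) < e"
      using h(1,2) by (intro exI[of _ m] exI[of _ "\<lambda>x. c * h x"]) auto
  qed
  have P_ind: "P (indicator A)" if "A \<in> sets Q" for A
  proof -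
    have G: "(\<Union>m. sets (F m)) \<subseteq> Pow (space Q)"
      using sets.space_closed sp by blast
    have stable: "Int_stable (\<Union>m. sets (F m))"
      unfolding Int_stable_def
    proof (intro ballI)
      fix a b assume "a \<in> (\<Union>m. sets (F m))" "b \<in> (\<Union>m. sets (F m))"
      then obtain m n where "a \<in> sets (F m)" "b \<in> sets (F n)" by blast
      then have "a \<in> sets (F (max m n))" "b \<in> sets (F (max m n))"
        using mono[of m "max m n"] mono[of n "max m n"] by auto
      then show "a \<inter> b \<in> (\<Union>m. sets (F m))" by auto
    qed
    have "A \<in> sigma_sets (space Q) (\<Union>m. sets (F m))" using that gen by simp
    with stable G show ?thesis
    proof (induction rule: sigma_sets_induct_disjoint)
      case (basic A)
      then obtain m where A: "A \<in> sets (F m)" by auto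
      then have "A \<in> sets Q" using sub[of m] unfolding subalgebra_def by auto
      with A show ?case by (intro P_self[of _ m]) (auto intro!: integrable_real_indicator simp: emeasure_eq_measure)
    next
      case empty
      show ?case by (intro P_self[of _ 0]) (auto simp: indicator_def)
    next
      case (compl A)
      then have A: "A \<in> sets Q" using gen by simp
      have int: "integrable Q (indicator A :: _ \<Rightarrow> real)"
        using A by (auto intro!: integrable_real_indicator simp: emeasure_eq_measure)
      have "P (\<lambda>x. 1 + (-1) * indicator A x)"
        using compl.IH int by (intro P_add P_cmult P_self[of "\<lambda>_. 1" 0]) auto
      \<comment> \<open>The two functions agree on \<open>space Q\<close> only. This is enough
        because \<open>P\<close> sees its argument only through integrals.\<close>
      moreover have "(\<integral>x. \<bar>indicator (space Q - A) x - h x\<bar> \<partial>Q) = (\<integral>x. \<bar>1 + (-1) * indicator A x - h x\<bar> \<partial>Q)"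
        for h :: "'b \<Rightarrow> real"
        by (intro Bochner_Integration.integral_cong) (auto simp: indicator_def)
      ultimately show ?case unfolding P_def by simp
    next
      case (union A)
      have A: "range A \<subseteq> sets Q" using union(2) gen by simp
      have int: "integrable Q (indicator B :: _ \<Rightarrow> real)" if "B \<in> sets Q" for B
        using that by (auto intro!: integrable_real_indicator simp: emeasure_eq_measure)
      have Pn: "P (indicator (\<Union>i<n. A i))" for n :: nat
      proof (induction n)
        case 0
        show ?case by (intro P_self[of _ 0]) (auto simp: indicator_def)
      next
        case (Suc n)
        have eq: "indicator (\<Union>i<Suc n. A i) = (\<lambda>x. indicator (\<Union>i<n. A i) x + indicator (A n) x :: real)"
        proof
          fix x
          have "x \<notin> A n" if "x \<in> A i" "i < n" for i
            using disjoint_family_onD[OF \<open>disjoint_family A\<close>, of i n] that by auto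
          then show "indicator (\<Union>i<Suc n. A i) x = (indicator (\<Union>i<n. A i) x + indicator (A n) x :: real)"
            by (auto simp: indicator_def lessThan_Suc)
        qed
        show ?case unfolding eq
          using Suc union(3) A by (intro P_add int) auto
      qed
      show ?case
      proof (rule P_lim[where s = "\<lambda>n. indicator (\<Union>i<n. A i)" and w = "\<lambda>_. 1"])
        show "integrable Q (indicator (\<Union>i. A i) :: _ \<Rightarrow> real)" using A by (intro int) auto
        show "integrable Q (indicator (\<Union>i<n. A i) :: _ \<Rightarrow> real)" for n using A by (intro int) auto
        show "(\<lambda>n. indicator (\<Union>i<n. A i) x :: real) \<longlonglongrightarrow> indicator (\<Union>i. A i) x" for x
          by (rule LIMSEQ_indicator_UN)
      qed (auto simp: Pn indicator_def)
    qed
  qed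
  have "P f" using f
  proof (induction rule: integrable_induct)
    case (base A c)
    have "integrable Q (indicator A :: _ \<Rightarrow> real)"
      using base by (auto intro!: integrable_real_indicator simp: emeasure_eq_measure)
    then have "P (\<lambda>x. c * indicator A x)" using P_ind base by (intro P_cmult) auto
    then show ?case by (simp add: mult.commute)
  next
    case (add f g)
    then show ?case by (intro P_add)
  next
    case (lim f s)
    \<comment> \<open>The factor 2 in the dominating function is the one supplied by
      \<open>integrable_induct\<close>.\<close>
    show ?case
      by (rule P_lim[where s = s and w = "\<lambda>x. 2 * \<bar>f x\<bar>"]) (use lim in auto)
  qed
  with \<open>e > 0\<close> that show ?thesis unfolding P_def by blast
qed

text \<open>Doob's inequality for the martingale closed by Y, by first passage. The event
  \<open>A n\<close> that the level c is exceeded for the first time at n belongs to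
  \<open>F n\<close>, so the conditional expectation can be replaced by Y on it. The events are
  disjoint and Y is nonnegative, hence the contributions add up to at most the mean of Y.\<close>

lemma conditional_expectation_maximal_inequality:
  fixes Y :: "'w \<Rightarrow> real" and F :: "nat \<Rightarrow> 'w measure"
  assumes "prob_space M"
    and sub: "\<And>n. subalgebra M (F n)"
    and mono: "\<And>m n. m \<le> n \<Longrightarrow> sets (F m) \<subseteq> sets (F n)"
    and Y: "integrable M Y" and Y0: "\<And>\<omega>. Y \<omega> \<ge> 0" and "c > 0"
  shows "measure M {\<omega>\<in>space M. \<exists>n. real_cond_exp M (F n) Y \<omega> > c} \<le> (\<integral>\<omega>. Y \<omega> \<partial>M) / c"
proof -
  interpret prob_space M by fact
  define Z where "Z n = real_cond_exp M (F n) Y" for n :: nat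
  define A where "A n = {\<omega>\<in>space M. Z n \<omega> > c \<and> (\<forall>i\<in>{..<n}. \<not> Z i \<omega> > c)}" for n
  have sp: "space (F m) = space M" for m using sub unfolding subalgebra_def by auto
  have subF: "subalgebra (F n) (F m)" if "m \<le> n" for m n
    using mono[OF that] sp unfolding subalgebra_def by auto
  have ZF: "Z i \<in> borel_measurable (F n)" if "i \<le> n" for i n
    unfolding Z_def by (rule measurable_from_subalg[OF subF[OF that]]) simp
  have AF: "A n \<in> sets (F n)" for n
  proof -
    have [measurable]: "Z n \<in> borel_measurable (F n)" "\<And>i. i \<in> {..<n} \<Longrightarrow> Z i \<in> borel_measurable (F n)"
      using ZF by auto
    have "{\<omega>\<in>space (F n). Z n \<omega> > c \<and> (\<forall>i\<in>{..<n}. \<not> Z i \<omega> > c)} \<in> sets (F n)"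
      by measurable
    then show ?thesis unfolding A_def sp .
  qed
  have AM[measurable]: "A n \<in> sets M" for n using AF sub unfolding subalgebra_def by blast
  have A_gt: "c < Z n \<omega>" if "\<omega> \<in> A n" for n \<omega> using that unfolding A_def by auto
  have disj: "disjoint_family A"
    unfolding disjoint_family_on_def
  proof (intro ballI impI)
    fix m n :: nat assume "m \<noteq> n"
    then show "A m \<inter> A n = {}" unfolding A_def by (cases "m < n") auto
  qed
  have UA: "{\<omega>\<in>space M. \<exists>n. Z n \<omega> > c} = (\<Union>n. A n)"
  proof safe
    fix \<omega> n assume "\<omega> \<in> space M" "Z n \<omega> > c"
    then have "Z (LEAST n. Z n \<omega> > c) \<omega> > c" "\<forall>i<(LEAST n. Z n \<omega> > c). \<not> Z i \<omega> > c"
      using LeastI[of "\<lambda>n. Z n \<omega> > c"] not_less_Least by auto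
    then show "\<omega> \<in> (\<Union>n. A n)" using \<open>\<omega> \<in> space M\<close> unfolding A_def by blast
  qed (auto simp: A_def)
  have step: "c * measure M (A n) \<le> (\<integral>\<omega>. indicator (A n) \<omega> * Y \<omega> \<partial>M)" for n
  proof -
    interpret Fn: finite_measure_subalgebra M "F n"
      by standard (rule sub)
    have intZ: "integrable M (Z n)" unfolding Z_def using Y by (rule Fn.real_cond_exp_int)
    have "c * measure M (A n) = (\<integral>\<omega>. c * indicator (A n) \<omega> \<partial>M)" by simp
    also have "\<dots> \<le> (\<integral>\<omega>. indicator (A n) \<omega> * Z n \<omega> \<partial>M)"
      using integrable_mult_indicator[OF AM intZ]
      by (intro integral_mono integrable_mult_right integrable_real_indicator)
        (auto simp: indicator_def emeasure_eq_measure dest: A_gt intro: less_imp_le)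
    also have "\<dots> = (\<integral>\<omega>. indicator (A n) \<omega> * Y \<omega> \<partial>M)"
      using Fn.real_cond_exp_intA[OF Y AF] unfolding Z_def set_lebesgue_integral_def by simp
    finally show ?thesis .
  qed
  have intA: "integrable M (\<lambda>\<omega>. indicator B \<omega> * Y \<omega>)" if "B \<in> sets M" for B
    using integrable_mult_indicator[OF that Y] by simp
  have "(\<lambda>n. measure M (A n)) sums measure M (\<Union>n. A n)"
    using disj by (intro finite_measure_UNION) auto
  then have sums: "(\<lambda>n. c * measure M (A n)) sums (c * measure M (\<Union>n. A n))" by (rule sums_mult)
  have "c * measure M (\<Union>n. A n) \<le> (\<integral>\<omega>. Y \<omega> \<partial>M)"
  proof (rule LIMSEQ_le_const2[OF sums[unfolded sums_def]], intro exI allI impI)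
    fix n :: nat
    have "(\<Sum>i<n. c * measure M (A i)) \<le> (\<Sum>i<n. \<integral>\<omega>. indicator (A i) \<omega> * Y \<omega> \<partial>M)"
      by (intro sum_mono step)
    also have "\<dots> = (\<integral>\<omega>. (\<Sum>i<n. indicator (A i) \<omega> * Y \<omega>) \<partial>M)"
      by (intro Bochner_Integration.integral_sum[symmetric] intA) auto
    also have "\<dots> = (\<integral>\<omega>. indicator (\<Union>i<n. A i) \<omega> * Y \<omega> \<partial>M)"
    proof -
      have "disjoint_family_on A {..<n}" using disj by (rule disjoint_family_on_mono[rotated]) auto
      then show ?thesis by (simp add: indicator_UN_disjoint sum_distrib_right)
    qed
    also have "\<dots> \<le> (\<integral>\<omega>. Y \<omega> \<partial>M)"
      using Y0 by (intro integral_mono intA Y) (auto simp: indicator_def)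
    finally show "(\<Sum>i<n. c * measure M (A i)) \<le> (\<integral>\<omega>. Y \<omega> \<partial>M)" .
  qed
  then show ?thesis using \<open>c > 0\<close> UA unfolding Z_def by (simp add: field_simps)
qed

section \<open>Kernels and semidirect products\<close>

text \<open>The integration is over M; F only fixes the sigma-field carried by the first factor.
  With this smaller sigma-field the measure is determined by rectangles whose first side lies in F,
  and these are the sets on which a conditional law given F is known.\<close>

definition semidirect :: "'w measure \<Rightarrow> 'w measure \<Rightarrow> ('w \<Rightarrow> 'b::topological_space measure) \<Rightarrow> ('w \<times> 'b) measure"
  where "semidirect M F \<kappa> = M \<bind> (\<lambda>\<omega>. distr (\<kappa> \<omega>) (F \<Otimes>\<^sub>M borel) (Pair \<omega>))"

text \<open>For an F-measurable \<kappa> this says that \<kappa> is a regular conditional law of Z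
  given F. Measurability is not built in, because \<alpha> is to satisfy the identity for the past
  at every n although it is measurable only for G_infinity.\<close>

definition disintegrates :: "'w measure \<Rightarrow> 'w measure \<Rightarrow> ('w \<Rightarrow> 'b::topological_space) \<Rightarrow> ('w \<Rightarrow> 'b measure) \<Rightarrow> bool"
  where "disintegrates M F Z \<kappa> \<longleftrightarrow> (\<forall>A\<in>sets F. \<forall>B\<in>sets borel.
    emeasure M (A \<inter> Z -` B) = (\<integral>\<^sup>+\<omega>. indicator A \<omega> * emeasure (\<kappa> \<omega>) B \<partial>M))"

lemma prob_kernelD:
  assumes "\<kappa> \<in> M \<rightarrow>\<^sub>M prob_algebra borel" "\<omega> \<in> space M"
  shows "prob_space (\<kappa> \<omega>)" "sets (\<kappa> \<omega>) = sets borel" "space (\<kappa> \<omega>) = UNIV"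
  using measurable_space[OF assms] sets_eq_imp_space_eq[of "\<kappa> \<omega>" borel] by (auto simp: space_prob_algebra)

context
  fixes M F :: "'w measure" and \<kappa> :: "'w \<Rightarrow> 'b::topological_space measure"
  assumes ps: "prob_space M" and sub: "subalgebra M F" and \<kappa>: "\<kappa> \<in> M \<rightarrow>\<^sub>M prob_algebra borel"
begin

lemma measurable_Pair_subalgebra: "\<omega> \<in> space M \<Longrightarrow> Pair \<omega> \<in> \<kappa> \<omega> \<rightarrow>\<^sub>M (F \<Otimes>\<^sub>M borel)"
  using prob_kernelD[OF \<kappa>, of \<omega>] sub
  by (subst measurable_cong_sets[of _ borel _ "F \<Otimes>\<^sub>M borel"]) (auto simp: subalgebra_def intro!: measurable_Pair1')

lemma measurable_semidirect_kernel:
  "(\<lambda>\<omega>. distr (\<kappa> \<omega>) (F \<Otimes>\<^sub>M borel) (Pair \<omega>)) \<in> M \<rightarrow>\<^sub>M subprob_algebra (F \<Otimes>\<^sub>M borel)"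
proof (rule measurable_distr2[where M = borel])
  have "id \<in> M \<rightarrow>\<^sub>M F" using sub by (auto simp: measurable_def subalgebra_def)
  then have [measurable]: "(\<lambda>x. x) \<in> M \<rightarrow>\<^sub>M F" by (simp add: id_def)
  have "(\<lambda>x. (fst x, snd x)) \<in> (M \<Otimes>\<^sub>M borel) \<rightarrow>\<^sub>M (F \<Otimes>\<^sub>M (borel :: 'b measure))"
    by (intro measurable_Pair measurable_compose[OF measurable_fst]) auto
  then show "case_prod Pair \<in> (M \<Otimes>\<^sub>M borel) \<rightarrow>\<^sub>M (F \<Otimes>\<^sub>M (borel :: 'b measure))"
    by (simp add: split_beta')
  show "\<kappa> \<in> M \<rightarrow>\<^sub>M subprob_algebra borel" using \<kappa> by (rule measurable_prob_algebraD)
qed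

lemma sets_semidirect: "sets (semidirect M F \<kappa>) = sets (F \<Otimes>\<^sub>M borel)"
  unfolding semidirect_def using prob_space.not_empty[OF ps] by (intro sets_bind) auto

lemma space_semidirect: "space (semidirect M F \<kappa>) = space M \<times> UNIV"
  using sets_eq_imp_space_eq[OF sets_semidirect] sub by (simp add: space_pair_measure subalgebra_def)

lemma nn_integral_semidirect:
  assumes f: "f \<in> borel_measurable (F \<Otimes>\<^sub>M borel)"
  shows "(\<integral>\<^sup>+z. f z \<partial>semidirect M F \<kappa>) = (\<integral>\<^sup>+\<omega>. \<integral>\<^sup>+x. f (\<omega>, x) \<partial>\<kappa> \<omega> \<partial>M)"
  unfolding semidirect_def
  by (subst nn_integral_bind[OF f measurable_semidirect_kernel], intro nn_integral_cong)
    (subst nn_integral_distr[OF measurable_Pair_subalgebra], use f in auto)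

lemma emeasure_semidirect:
  assumes C: "C \<in> sets (F \<Otimes>\<^sub>M borel)"
  shows "emeasure (semidirect M F \<kappa>) C = (\<integral>\<^sup>+\<omega>. emeasure (\<kappa> \<omega>) (Pair \<omega> -` C) \<partial>M)"
proof -
  have "emeasure (semidirect M F \<kappa>) C = (\<integral>\<^sup>+z. indicator C z \<partial>semidirect M F \<kappa>)"
    using C sets_semidirect by simp
  also have "\<dots> = (\<integral>\<^sup>+\<omega>. \<integral>\<^sup>+x. indicator C (\<omega>, x) \<partial>\<kappa> \<omega> \<partial>M)"
    using C by (intro nn_integral_semidirect) auto
  also have "\<dots> = (\<integral>\<^sup>+\<omega>. emeasure (\<kappa> \<omega>) (Pair \<omega> -` C) \<partial>M)"
  proof (intro nn_integral_cong)
    fix \<omega> assume \<omega>: "\<omega> \<in> space M"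
    have "(\<integral>\<^sup>+x. indicator C (\<omega>, x) \<partial>\<kappa> \<omega>) = (\<integral>\<^sup>+x. indicator (Pair \<omega> -` C) x \<partial>\<kappa> \<omega>)"
      by (intro nn_integral_cong) (auto simp: indicator_def)
    also have "\<dots> = emeasure (\<kappa> \<omega>) (Pair \<omega> -` C)"
      using measurable_sets[OF measurable_Pair_subalgebra[OF \<omega>] C] prob_kernelD[OF \<kappa> \<omega>] by simp
    finally show "(\<integral>\<^sup>+x. indicator C (\<omega>, x) \<partial>\<kappa> \<omega>) = emeasure (\<kappa> \<omega>) (Pair \<omega> -` C)" .
  qed
  finally show ?thesis .
qed

lemma emeasure_semidirect_Times:
  assumes "A \<in> sets F" "B \<in> sets borel"
  shows "emeasure (semidirect M F \<kappa>) (A \<times> B) = (\<integral>\<^sup>+\<omega>. indicator A \<omega> * emeasure (\<kappa> \<omega>) B \<partial>M)"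
proof -
  have "emeasure (semidirect M F \<kappa>) (A \<times> B) = (\<integral>\<^sup>+\<omega>. emeasure (\<kappa> \<omega>) (Pair \<omega> -` (A \<times> B)) \<partial>M)"
    using assms by (intro emeasure_semidirect) auto
  also have "\<dots> = (\<integral>\<^sup>+\<omega>. indicator A \<omega> * emeasure (\<kappa> \<omega>) B \<partial>M)"
    by (intro nn_integral_cong) (auto simp: indicator_def)
  finally show ?thesis .
qed

lemma prob_space_semidirect: "prob_space (semidirect M F \<kappa>)"
proof
  have "emeasure (semidirect M F \<kappa>) (space M \<times> UNIV) = (\<integral>\<^sup>+\<omega>. indicator (space M) \<omega> * emeasure (\<kappa> \<omega>) UNIV \<partial>M)"
    using sub by (intro emeasure_semidirect_Times) (auto simp: subalgebra_def, metis sets.top)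
  also have "\<dots> = (\<integral>\<^sup>+\<omega>. 1 \<partial>M)"
    using prob_space.emeasure_space_1[OF prob_kernelD(1)[OF \<kappa>]] prob_kernelD(3)[OF \<kappa>] by (intro nn_integral_cong) auto
  also have "\<dots> = 1" using prob_space.emeasure_space_1[OF ps] by simp
  finally show "emeasure (semidirect M F \<kappa>) (space (semidirect M F \<kappa>)) = 1"
    by (simp add: space_semidirect)
qed

lemma semidirect_eqI:
  assumes sets: "sets \<nu> = sets (F \<Otimes>\<^sub>M borel)"
    and eq: "\<And>A B. A \<in> sets F \<Longrightarrow> B \<in> sets borel \<Longrightarrow>
      emeasure \<nu> (A \<times> B) = (\<integral>\<^sup>+\<omega>. indicator A \<omega> * emeasure (\<kappa> \<omega>) B \<partial>M)"
  shows "\<nu> = semidirect M F \<kappa>"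
proof (rule measure_eqI_generator_eq[OF Int_stable_pair_measure_generator, of F borel, where \<Omega> = "space F \<times> UNIV" and A = "\<lambda>_. space F \<times> UNIV"])
  show "{a \<times> b |a b. a \<in> sets F \<and> b \<in> sets borel} \<subseteq> Pow (space F \<times> UNIV)"
    by (auto dest: sets.sets_into_space)
  show "emeasure \<nu> X = emeasure (semidirect M F \<kappa>) X" if "X \<in> {a \<times> b |a b. a \<in> sets F \<and> b \<in> sets borel}" for X
    using that eq emeasure_semidirect_Times by auto
  show "sets \<nu> = sigma_sets (space F \<times> UNIV) {a \<times> b |a b. a \<in> sets F \<and> b \<in> sets borel}"
    "sets (semidirect M F \<kappa>) = sigma_sets (space F \<times> UNIV) {a \<times> b |a b. a \<in> sets F \<and> b \<in> sets borel}"
    using sets sets_semidirect by (auto simp: sets_pair_measure)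
  have "emeasure \<nu> (space F \<times> UNIV) = emeasure (semidirect M F \<kappa>) (space F \<times> UNIV)"
    using eq[of "space F" UNIV] emeasure_semidirect_Times[of "space F" UNIV] by auto
  moreover have "emeasure (semidirect M F \<kappa>) (space F \<times> UNIV) = 1"
    using prob_space.emeasure_space_1[OF prob_space_semidirect] sub
    by (simp add: space_semidirect subalgebra_def)
  ultimately show "emeasure \<nu> (space F \<times> UNIV) \<noteq> \<infinity>" by simp
  show "range (\<lambda>_. space F \<times> UNIV) \<subseteq> {a \<times> b |a b. a \<in> sets F \<and> b \<in> sets (borel :: 'b measure)}"
    by (intro image_subsetI CollectI exI[of _ "space F"] exI[of _ UNIV]) auto
qed auto

lemma measurable_graph_subalgebra:
  assumes "Z \<in> M \<rightarrow>\<^sub>M borel"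
  shows "(\<lambda>\<omega>. (\<omega>, Z \<omega>)) \<in> M \<rightarrow>\<^sub>M (F \<Otimes>\<^sub>M borel)"
proof -
  have "id \<in> M \<rightarrow>\<^sub>M F" using sub by (auto simp: measurable_def subalgebra_def)
  then have "(\<lambda>x. x) \<in> M \<rightarrow>\<^sub>M F" by (simp add: id_def)
  then show ?thesis using assms by (intro measurable_Pair)
qed

text \<open>Rectangles determine the law of the pair, so from here on events and integrands that
  depend jointly on \<omega> and Z can be evaluated section by section.\<close>

lemma disintegrates_imp_distr_eq_semidirect:
  assumes Z: "Z \<in> M \<rightarrow>\<^sub>M borel" and d: "disintegrates M F Z \<kappa>"
  shows "distr M (F \<Otimes>\<^sub>M borel) (\<lambda>\<omega>. (\<omega>, Z \<omega>)) = semidirect M F \<kappa>"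
proof (rule semidirect_eqI)
  fix A :: "'w set" and B :: "'b set" assume A: "A \<in> sets F" and B: "B \<in> sets borel"
  have "emeasure (distr M (F \<Otimes>\<^sub>M borel) (\<lambda>\<omega>. (\<omega>, Z \<omega>))) (A \<times> B) = emeasure M ((\<lambda>\<omega>. (\<omega>, Z \<omega>)) -` (A \<times> B) \<inter> space M)"
    using A B measurable_graph_subalgebra[OF Z] by (intro emeasure_distr) auto
  also have "(\<lambda>\<omega>. (\<omega>, Z \<omega>)) -` (A \<times> B) \<inter> space M = A \<inter> Z -` B"
    using sets.sets_into_space[OF A] sub by (auto simp: subalgebra_def)
  finally show "emeasure (distr M (F \<Otimes>\<^sub>M borel) (\<lambda>\<omega>. (\<omega>, Z \<omega>))) (A \<times> B) = (\<integral>\<^sup>+\<omega>. indicator A \<omega> * emeasure (\<kappa> \<omega>) B \<partial>M)"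
    using d A B unfolding disintegrates_def by simp
qed simp

end

section \<open>Jointly measurable densities of kernels\<close>

text \<open>One Radon-Nikodym derivative is taken on the product instead of one for each \<omega>,
  which yields joint measurability. For a fixed B its fibre integrals agree with
  \<open>emeasure (\<kappa> \<omega>) B\<close> for almost all \<omega>, by uniqueness of densities
  over N. Equality on a countable determining class then identifies the measures themselves.\<close>

lemma kernel_density:
  fixes lam :: "'b::polish_space measure"
  assumes ps: "prob_space N" and \<kappa>: "\<kappa> \<in> N \<rightarrow>\<^sub>M prob_algebra borel"
    and lam: "sets lam = sets borel" "sigma_finite_measure lam"
    and ac: "absolutely_continuous (N \<Otimes>\<^sub>M lam) (semidirect N N \<kappa>)"
  obtains g where "g \<in> borel_measurable (N \<Otimes>\<^sub>M lam)" "AE \<omega> in N. \<kappa> \<omega> = density lam (\<lambda>x. g (\<omega>, x))"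
proof -
  interpret N: prob_space N by fact
  interpret lam: sigma_finite_measure lam by fact
  interpret P: pair_sigma_finite N lam ..
  have sub: "subalgebra N N" by (simp add: subalgebra_def)
  note sd = ps sub \<kappa>
  have spl: "space lam = UNIV" using sets_eq_imp_space_eq[OF lam(1)] by simp
  have setsP: "sets (N \<Otimes>\<^sub>M lam) = sets (N \<Otimes>\<^sub>M borel)" using lam(1) by (intro sets_pair_measure_cong) auto
  obtain g where g[measurable]: "g \<in> borel_measurable (N \<Otimes>\<^sub>M lam)" and dens: "density (N \<Otimes>\<^sub>M lam) g = semidirect N N \<kappa>"
    using P.Radon_Nikodym[OF ac] setsP sets_semidirect[OF sd] by auto
  obtain K :: "'b set set" where K: "countable K" "\<forall>C\<in>K. open C" "distance_determining K"
    using ex_countable_distance_determining by blast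
  have AEB: "AE \<omega> in N. emeasure (\<kappa> \<omega>) B = (\<integral>\<^sup>+x. g (\<omega>, x) * indicator B x \<partial>lam)" if B: "B \<in> sets borel" for B
  proof -
    have Bl[measurable]: "B \<in> sets lam" using B lam by simp
    have [measurable]: "(\<lambda>\<omega>. emeasure (\<kappa> \<omega>) B) \<in> borel_measurable N"
      using measurable_emeasure_kernel[OF measurable_prob_algebraD[OF \<kappa>]] B by auto
    have "density N (\<lambda>\<omega>. emeasure (\<kappa> \<omega>) B) = density N (\<lambda>\<omega>. \<integral>\<^sup>+x. g (\<omega>, x) * indicator B x \<partial>lam)"
    proof (rule measure_eqI)
      fix A assume "A \<in> sets (density N (\<lambda>\<omega>. emeasure (\<kappa> \<omega>) B))"
      then have A[measurable]: "A \<in> sets N" by simp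
      have "emeasure (density N (\<lambda>\<omega>. emeasure (\<kappa> \<omega>) B)) A = emeasure (semidirect N N \<kappa>) (A \<times> B)"
        using A B by (simp add: emeasure_density emeasure_semidirect_Times[OF sd] mult.commute)
      also have "\<dots> = (\<integral>\<^sup>+z. g z * indicator (A \<times> B) z \<partial>(N \<Otimes>\<^sub>M lam))"
        unfolding dens[symmetric] by (intro emeasure_density) auto
      also have "\<dots> = (\<integral>\<^sup>+\<omega>. \<integral>\<^sup>+x. g (\<omega>, x) * indicator (A \<times> B) (\<omega>, x) \<partial>lam \<partial>N)"
        by (subst lam.nn_integral_fst[symmetric]) auto
      also have "\<dots> = (\<integral>\<^sup>+\<omega>. (\<integral>\<^sup>+x. g (\<omega>, x) * indicator B x \<partial>lam) * indicator A \<omega> \<partial>N)"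
        by (intro nn_integral_cong) (auto simp: indicator_def)
      also have "\<dots> = emeasure (density N (\<lambda>\<omega>. \<integral>\<^sup>+x. g (\<omega>, x) * indicator B x \<partial>lam)) A"
        by (subst emeasure_density) auto
      finally show "emeasure (density N (\<lambda>\<omega>. emeasure (\<kappa> \<omega>) B)) A = emeasure (density N (\<lambda>\<omega>. \<integral>\<^sup>+x. g (\<omega>, x) * indicator B x \<partial>lam)) A" .
    qed simp
    then show ?thesis by (subst (asm) N.density_unique_iff) auto
  qed
  \<comment> \<open>\<open>UNIV\<close> is added because the density measure must be known to be
    finite before the determining class applies to it.\<close>
  have "AE \<omega> in N. \<forall>B\<in>insert UNIV K. emeasure (\<kappa> \<omega>) B = (\<integral>\<^sup>+x. g (\<omega>, x) * indicator B x \<partial>lam)"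
  proof (subst AE_ball_countable)
    show "countable (insert UNIV K)" using K(1) by simp
    show "\<forall>B\<in>insert UNIV K. AE \<omega> in N. emeasure (\<kappa> \<omega>) B = (\<integral>\<^sup>+x. g (\<omega>, x) * indicator B x \<partial>lam)"
      using K(2) by (intro ballI AEB) auto
  qed
  with AE_space have "AE \<omega> in N. \<kappa> \<omega> = density lam (\<lambda>x. g (\<omega>, x))"
  proof eventually_elim
    fix \<omega> assume \<omega>: "\<omega> \<in> space N"
      and eq: "\<forall>B\<in>insert UNIV K. emeasure (\<kappa> \<omega>) B = (\<integral>\<^sup>+x. g (\<omega>, x) * indicator B x \<partial>lam)"
    let ?d = "density lam (\<lambda>x. g (\<omega>, x))"
    note k = prob_kernelD[OF \<kappa> \<omega>]
    have sd: "sets ?d = sets borel" using lam by simp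
    have [measurable]: "(\<lambda>x. g (\<omega>, x)) \<in> borel_measurable lam" using \<omega> by measurable
    have eqK: "emeasure (\<kappa> \<omega>) B = emeasure ?d B" if "B \<in> insert UNIV K" for B
    proof -
      have "B \<in> sets lam" using that K(2) lam by auto
      then have "emeasure ?d B = (\<integral>\<^sup>+x. g (\<omega>, x) * indicator B x \<partial>lam)" by (intro emeasure_density) auto
      with bspec[OF eq that] show ?thesis by simp
    qed
    have f1: "finite_measure (\<kappa> \<omega>)" using k(1) by (simp add: prob_space_def)
    have f2: "finite_measure ?d"
      using eqK[of UNIV] finite_measure.emeasure_finite[OF f1, of UNIV] spl by (intro finite_measureI) simp
    show "\<kappa> \<omega> = ?d"
      using eqK by (intro finite_measure_eqI_determining[OF K(3) k(2) sd f1 f2]) auto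
  qed
  with g that show ?thesis by blast
qed

section \<open>The past of a c.i.d. sequence\<close>

definition obs :: "(nat \<Rightarrow> 'w \<Rightarrow> 'b) \<Rightarrow> nat \<Rightarrow> 'w \<Rightarrow> nat \<Rightarrow> 'b" where
  "obs X n \<omega> = (\<lambda>i\<in>{..<n}. X i \<omega>)"

lemma joint_law_obs: "joint_law M X n = distr M (\<Pi>\<^sub>M i\<in>{..<n}. borel) (obs X n)"
  unfolding joint_law_def obs_def ..

lemma obs_Suc: "obs X (Suc n) \<omega> = (obs X n \<omega>)(n := X n \<omega>)"
  unfolding obs_def by (auto simp: restrict_def)

lemma restrict_obs: "m \<le> n \<Longrightarrow> restrict (obs X n \<omega>) {..<m} = obs X m \<omega>"
  unfolding obs_def by (auto simp: restrict_def)

lemma space_past: "space (past M X n) = space M"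
  and sets_past: "sets (past M X n) = sigma_sets (space M) (\<Union>i<n. {X i -` B \<inter> space M | B. B \<in> sets borel})"
proof -
  have "(\<Union>i<n. {X i -` B \<inter> space M | B. B \<in> sets borel}) \<subseteq> Pow (space M)" by auto
  then show "space (past M X n) = space M"
    "sets (past M X n) = sigma_sets (space M) (\<Union>i<n. {X i -` B \<inter> space M | B. B \<in> sets borel})"
    unfolding past_def by (auto simp: space_measure_of_conv sets_measure_of)
qed

lemma measurable_past: "i < n \<Longrightarrow> X i \<in> past M X n \<rightarrow>\<^sub>M borel"
  by (rule measurableI) (auto simp: space_past sets_past intro!: sigma_sets.Basic)

lemma obs_measurable_past: "obs X n \<in> past M X n \<rightarrow>\<^sub>M (\<Pi>\<^sub>M i\<in>{..<n}. borel)"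
  unfolding obs_def by (rule measurable_restrict) (auto intro: measurable_past)

text \<open>The preimages under \<open>obs X n\<close> form a sigma-field on \<open>space M\<close>
  that contains all generators of the past.\<close>

lemma sets_past_obs:
  assumes "A \<in> sets (past M X n)"
  obtains D where "D \<in> sets (\<Pi>\<^sub>M i\<in>{..<n}. borel)" "A = obs X n -` D \<inter> space M"
proof -
  let ?V = "vimage_algebra (space M) (obs X n) (\<Pi>\<^sub>M i\<in>{..<n}. borel)"
  have "X i -` B \<inter> space M \<in> sets ?V" if "i < n" "B \<in> sets borel" for i B
  proof -
    have "obs X n \<in> ?V \<rightarrow>\<^sub>M (\<Pi>\<^sub>M i\<in>{..<n}. borel)"
      by (rule measurable_vimage_algebra1) (auto simp: obs_def space_PiM)
    from measurable_compose[OF this measurable_component_singleton[of i]]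
    have "(\<lambda>\<omega>. obs X n \<omega> i) \<in> ?V \<rightarrow>\<^sub>M borel" using that by simp
    moreover have "(\<lambda>\<omega>. obs X n \<omega> i) = X i" using that by (auto simp: obs_def)
    ultimately have "X i \<in> ?V \<rightarrow>\<^sub>M borel" by simp
    from measurable_sets[OF this that(2)] show ?thesis by simp
  qed
  then have "sets (past M X n) \<subseteq> sets ?V"
    unfolding sets_past
  proof (intro sets.sigma_sets_subset')
    show "space M \<in> sets ?V" using sets.top[of ?V] by simp
  qed auto
  with assms have "A \<in> sets ?V" by blast
  then show ?thesis using that by (auto simp: sets_vimage_algebra2 obs_def space_PiM)
qed

text \<open>The same argument on \<Omega> x S, where the second component takes the place of the
  next observation. It translates null sets over the past into sets of n + 1 coordinates, on which
  the joint law can be used.\<close>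

lemma sets_past_pair_obs:
  fixes X :: "nat \<Rightarrow> 'w \<Rightarrow> 'b::topological_space"
  assumes "C \<in> sets (past M X n \<Otimes>\<^sub>M borel)"
  obtains D where "D \<in> sets (\<Pi>\<^sub>M i\<in>{..<Suc n}. borel)"
    "C = {z \<in> space M \<times> UNIV. (obs X n (fst z))(n := snd z) \<in> D}"
proof -
  let ?\<Phi> = "\<lambda>z. (obs X n (fst z))(n := snd z)"
  let ?V = "vimage_algebra (space M \<times> UNIV) ?\<Phi> (\<Pi>\<^sub>M i\<in>{..<Suc n}. (borel :: 'b measure))"
  have \<Phi>sp: "?\<Phi> \<in> space M \<times> UNIV \<rightarrow> space (\<Pi>\<^sub>M i\<in>{..<Suc n}. (borel :: 'b measure))"
    by (auto simp: obs_def space_PiM PiE_def extensional_def)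
  have \<Phi>: "?\<Phi> \<in> ?V \<rightarrow>\<^sub>M (\<Pi>\<^sub>M i\<in>{..<Suc n}. borel)"
    by (rule measurable_vimage_algebra1[OF \<Phi>sp])
  have comp: "(\<lambda>z. ?\<Phi> z i) \<in> ?V \<rightarrow>\<^sub>M borel" if "i < Suc n" for i
    using measurable_compose[OF \<Phi> measurable_component_singleton[of i]] that by simp
  have snd: "snd \<in> ?V \<rightarrow>\<^sub>M borel" using comp[of n] by (simp cong: measurable_cong)
  have fst: "fst \<in> ?V \<rightarrow>\<^sub>M past M X n"
    unfolding past_def
  proof (rule measurable_measure_of)
    show "fst \<in> space ?V \<rightarrow> space M" by auto
    fix y assume "y \<in> (\<Union>i<n. {X i -` B \<inter> space M | B. B \<in> sets borel})"
    then obtain i B where i: "i < n" "B \<in> sets borel" "y = X i -` B \<inter> space M" by auto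
    have "(\<lambda>z. ?\<Phi> z i) -` B \<inter> space ?V \<in> sets ?V"
      using i by (intro measurable_sets[OF comp]) auto
    moreover have "(\<lambda>z. ?\<Phi> z i) -` B \<inter> space ?V = fst -` y \<inter> space ?V"
      using i by (auto simp: obs_def)
    ultimately show "fst -` y \<inter> space ?V \<in> sets ?V" by simp
  qed auto
  have "sets (past M X n \<Otimes>\<^sub>M (borel :: 'b measure)) \<subseteq> sets ?V"
  proof (rule sets_pair_in_sets)
    fix a and b :: "'b set" assume a: "a \<in> sets (past M X n)" and b: "b \<in> sets borel"
    have "(fst -` a \<inter> space ?V) \<inter> (snd -` b \<inter> space ?V) \<in> sets ?V"
      using measurable_sets[OF fst a] measurable_sets[OF snd b] by (rule sets.Int)
    moreover have "(fst -` a \<inter> space ?V) \<inter> (snd -` b \<inter> space ?V) = a \<times> b"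
      using sets.sets_into_space[OF a] by (auto simp: space_past)
    ultimately show "a \<times> b \<in> sets ?V" by simp
  qed
  with assms have "C \<in> sets ?V" by blast
  then obtain D where "D \<in> sets (\<Pi>\<^sub>M i\<in>{..<Suc n}. (borel :: 'b measure))" "C = ?\<Phi> -` D \<inter> (space M \<times> UNIV)"
    unfolding sets_vimage_algebra2[OF \<Phi>sp] by auto
  then show ?thesis using that[of D] by (auto simp: vimage_def Int_def)
qed

lemma past_mono: "m \<le> n \<Longrightarrow> sets (past M X m) \<subseteq> sets (past M X n)"
  unfolding sets_past by (intro sigma_sets_mono' UN_mono) auto

lemma space_past_infinity: "space (past_infinity M X) = space M"
  and sets_past_infinity: "sets (past_infinity M X) = sigma_sets (space M) (\<Union>n. sets (past M X n))"
proof -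
  have "(\<Union>n. sets (past M X n)) \<subseteq> Pow (space M)"
    using sets.sets_into_space[where M = "past M X _"] unfolding space_past by auto
  then show "space (past_infinity M X) = space M"
    "sets (past_infinity M X) = sigma_sets (space M) (\<Union>n. sets (past M X n))"
    unfolding past_infinity_def by (auto simp: space_measure_of_conv sets_measure_of)
qed

context
  fixes M :: "'w measure" and X :: "nat \<Rightarrow> 'w \<Rightarrow> 'b::topological_space"
  assumes X: "\<And>i. X i \<in> M \<rightarrow>\<^sub>M borel"
begin

lemma subalgebra_past: "subalgebra M (past M X n)"
  unfolding subalgebra_def space_past sets_past
  using measurable_sets[OF X] by (auto intro!: sets.sigma_sets_subset)

lemma subalgebra_past_infinity: "subalgebra M (past_infinity M X)"
  unfolding subalgebra_def space_past_infinity sets_past_infinity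
  using subalgebra_past by (auto intro!: sets.sigma_sets_subset simp: subalgebra_def)

lemma obs_measurable: "obs X n \<in> M \<rightarrow>\<^sub>M (\<Pi>\<^sub>M i\<in>{..<n}. borel)"
  by (rule measurable_from_subalg[OF subalgebra_past obs_measurable_past])

end

text \<open>One step is the c.i.d. identity evaluated on the vectors whose first n entries lie in D
  and whose last entry lies in B. The step iterates because an event of the first n observations is
  also an event of the first m for every m \<ge> n.\<close>

lemma cid_past_swap:
  fixes X :: "nat \<Rightarrow> 'w \<Rightarrow> 'b::topological_space"
  assumes X: "\<And>i. X i \<in> M \<rightarrow>\<^sub>M borel" and cid: "cid M X"
    and A: "A \<in> sets (past M X n)" and B: "B \<in> sets borel" and "n \<le> m"
  shows "emeasure M (A \<inter> X m -` B) = emeasure M (A \<inter> X n -` B)"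
proof -
  have one: "emeasure M (A \<inter> X (Suc n) -` B) = emeasure M (A \<inter> X n -` B)"
    if A: "A \<in> sets (past M X n)" for A n
  proof -
    obtain D where D: "D \<in> sets (\<Pi>\<^sub>M i\<in>{..<n}. borel)" "A = obs X n -` D \<inter> space M"
      using sets_past_obs[OF A] .
    let ?P = "\<Pi>\<^sub>M i\<in>{..<Suc n}. (borel :: 'b measure)"
    define E where "E = {z \<in> space ?P. restrict z {..<n} \<in> D \<and> z n \<in> B}"
    have "E = ((\<lambda>z. restrict z {..<n}) -` D \<inter> space ?P) \<inter> ((\<lambda>z. z n) -` B \<inter> space ?P)"
      unfolding E_def by auto
    also have "\<dots> \<in> sets ?P"
      using D B by (intro sets.Int measurable_sets[OF measurable_restrict_subset] measurable_sets[OF measurable_component_singleton]) auto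
    finally have E: "E \<in> sets ?P" .
    let ?X' = "X(n := X (Suc n))"
    have X': "?X' i \<in> M \<rightarrow>\<^sub>M borel" for i using X by auto
    have in_sp: "obs Y (Suc n) \<omega> \<in> space ?P" for Y :: "nat \<Rightarrow> 'w \<Rightarrow> 'b" and \<omega>
      by (auto simp: obs_def space_PiM)
    have "emeasure M (A \<inter> X (Suc n) -` B) = emeasure M (obs ?X' (Suc n) -` E \<inter> space M)"
    proof -
      have "obs ?X' n \<omega> = obs X n \<omega>" for \<omega> by (auto simp: obs_def restrict_def)
      then have "obs ?X' (Suc n) -` E \<inter> space M = A \<inter> X (Suc n) -` B"
        using in_sp[of ?X'] unfolding E_def D(2) by (auto simp: restrict_obs) (auto simp: obs_def)
      then show ?thesis by simp
    qed
    also have "\<dots> = emeasure (joint_law M ?X' (Suc n)) E"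
      unfolding joint_law_obs by (rule emeasure_distr[symmetric, OF obs_measurable[OF X'] E])
    also have "\<dots> = emeasure (joint_law M X (Suc n)) E"
      using cid unfolding cid_def by simp
    also have "\<dots> = emeasure M (obs X (Suc n) -` E \<inter> space M)"
      unfolding joint_law_obs by (rule emeasure_distr[OF obs_measurable[OF X] E])
    also have "obs X (Suc n) -` E \<inter> space M = A \<inter> X n -` B"
      using in_sp[of X] unfolding E_def D(2) by (auto simp: restrict_obs) (auto simp: obs_def)
    finally show ?thesis .
  qed
  from \<open>n \<le> m\<close> show ?thesis
  proof (induction m rule: dec_induct)
    case (step m)
    then show ?case using one[of A m] past_mono[of n m M X] A by auto
  qed simp
qed

section \<open>Predictive measures and their limit as conditional laws\<close>

lemma predictive_disintegrates:
  assumes ps: "prob_space M" and X: "\<And>i. X i \<in> M \<rightarrow>\<^sub>M borel"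
    and pred: "predictive_measures M X \<alpha>n" and n: "n \<ge> 1"
  shows "disintegrates M (past M X n) (X n) (\<alpha>n n)"
  unfolding disintegrates_def
proof (intro ballI)
  interpret prob_space M by fact
  fix A and B :: "'b set" assume A: "A \<in> sets (past M X n)" and B: "B \<in> sets borel"
  have sub: "subalgebra M (past M X n)" by (rule subalgebra_past[OF X])
  interpret F: finite_measure_subalgebra M "past M X n" by standard (rule sub)
  have AM: "A \<in> sets M" using A sub unfolding subalgebra_def by auto
  have \<alpha>: "\<alpha>n n \<in> M \<rightarrow>\<^sub>M prob_algebra borel"
    using pred n unfolding predictive_measures_def random_prob_measure_def by auto
  let ?E = "X n -` B \<inter> space M"
  have E[measurable]: "?E \<in> sets M" using measurable_sets[OF X B] .
  have ver: "AE \<omega> in M. measure (\<alpha>n n \<omega>) B = real_cond_exp M (past M X n) (indicator ?E) \<omega>"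
    using pred n B unfolding predictive_measures_def cond_prob_version_def by auto
  have [measurable]: "(\<lambda>\<omega>. measure (\<alpha>n n \<omega>) B) \<in> borel_measurable M"
    by (rule measurable_compose[OF \<alpha> measurable_measure_prob_algebra[OF B]])
  have intE: "integrable M (indicator ?E :: _ \<Rightarrow> real)" by (auto intro!: integrable_real_indicator simp: emeasure_eq_measure)
  have "measure M (A \<inter> ?E) = (\<integral>\<omega>. indicator A \<omega> * indicator ?E \<omega> \<partial>M)"
    using AM E by (simp flip: indicator_inter_arith) 
  also have "\<dots> = (\<integral>\<omega>. indicator A \<omega> * real_cond_exp M (past M X n) (indicator ?E) \<omega> \<partial>M)"
    using F.real_cond_exp_intA[OF intE A] by (simp add: set_lebesgue_integral_def)
  also have "\<dots> = (\<integral>\<omega>. indicator A \<omega> * measure (\<alpha>n n \<omega>) B \<partial>M)"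
    using ver AM by (intro integral_cong_AE) auto
  finally have eq: "measure M (A \<inter> ?E) = (\<integral>\<omega>. indicator A \<omega> * measure (\<alpha>n n \<omega>) B \<partial>M)" .
  have le1: "measure (\<alpha>n n \<omega>) B \<le> 1" if "\<omega> \<in> space M" for \<omega>
    using prob_kernelD(1)[OF \<alpha> that] by (rule prob_space.prob_le_1)
  have "(\<integral>\<^sup>+\<omega>. indicator A \<omega> * emeasure (\<alpha>n n \<omega>) B \<partial>M) = (\<integral>\<^sup>+\<omega>. ennreal (indicator A \<omega> * measure (\<alpha>n n \<omega>) B) \<partial>M)"
    using finite_measure.emeasure_eq_measure[OF prob_space.finite_measure[OF prob_kernelD(1)[OF \<alpha>]]]
    by (intro nn_integral_cong) (auto simp: indicator_def)
  also have "\<dots> = ennreal (\<integral>\<omega>. indicator A \<omega> * measure (\<alpha>n n \<omega>) B \<partial>M)"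
    using AM le1 by (intro nn_integral_eq_integral integrable_const_bound[of _ 1]) (auto simp: indicator_def)
  also have "\<dots> = emeasure M (A \<inter> ?E)" by (simp add: eq emeasure_eq_measure)
  also have "A \<inter> ?E = A \<inter> X n -` B" using sets.sets_into_space[OF AM] by auto
  finally show "emeasure M (A \<inter> X n -` B) = (\<integral>\<^sup>+\<omega>. indicator A \<omega> * emeasure (\<alpha>n n \<omega>) B \<partial>M)" by simp
qed

lemma open_indicator_limit:
  fixes U :: "'b::metric_space set"
  assumes "open U"
  obtains f :: "nat \<Rightarrow> 'b \<Rightarrow> real" where "\<And>k. continuous_on UNIV (f k)" "\<And>k x. 0 \<le> f k x" "\<And>k x. f k x \<le> 1"
    "\<And>x. (\<lambda>k. f k x) \<longlonglongrightarrow> indicator U x"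
\<comment> \<open>\<open>infdist\<close> to the empty set is 0, so the formula of the second case
  would give 0 instead of 1 when U is the whole space.\<close>
proof (cases "U = UNIV")
  case True
  then show ?thesis using that[of "\<lambda>_ _. 1"] by auto
next
  case False
  define f where "f k x = min 1 (real k * infdist x (-U))" for k :: nat and x
  have lim: "(\<lambda>k. f k x) \<longlonglongrightarrow> indicator U x" for x
  proof (cases "x \<in> U")
    case True
    then have "infdist x (-U) > 0"
      using assms \<open>U \<noteq> UNIV\<close> by (intro infdist_pos_not_in_closed) (auto simp: closed_def)
    then obtain N :: nat where N: "1 < real N * infdist x (-U)" using reals_Archimedean3 by blast
    have "f k x = 1" if "k \<ge> N" for k
    proof -
      have "real N * infdist x (-U) \<le> real k * infdist x (-U)"
        using that \<open>infdist x (-U) > 0\<close> by (intro mult_right_mono) auto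
      with N show ?thesis unfolding f_def by simp
    qed
    then have "eventually (\<lambda>k. f k x = indicator U x) sequentially"
      using True by (auto simp: eventually_sequentially)
    then show ?thesis by (rule tendsto_eventually)
  next
    case False
    then have "f k x = 0" for k unfolding f_def by simp
    with False show ?thesis by simp
  qed
  show ?thesis
  proof (rule that[of f])
    show "continuous_on UNIV (f k)" for k unfolding f_def
      by (intro continuous_intros)
    show "0 \<le> f k x" "f k x \<le> 1" for k x unfolding f_def by (auto intro!: mult_nonneg_nonneg infdist_nonneg)
  qed (rule lim)
qed

text \<open>The law \<open>\<nu> m\<close> of \<open>X m\<close> on the event A is the same for all
  m \<ge> n, and it is also the average of the m-th predictive measure over A. Letting m grow moves
  this average to \<alpha> for bounded continuous integrands. Open sets follow by approximating
  their indicators, and Borel sets by the determining class.\<close>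

lemma cid_limit_disintegrates:
  fixes X :: "nat \<Rightarrow> 'w \<Rightarrow> 'b::polish_space"
  assumes ps: "prob_space M" and X: "\<And>i. X i \<in> M \<rightarrow>\<^sub>M borel" and cid: "cid M X"
    and pred: "predictive_measures M X \<alpha>n" and \<alpha>: "\<alpha> \<in> M \<rightarrow>\<^sub>M prob_algebra borel"
    and weak: "AE \<omega> in M. weakly_converges (\<lambda>n. \<alpha>n n \<omega>) (\<alpha> \<omega>)"
  shows "disintegrates M (past M X n) (X n) \<alpha>"
  unfolding disintegrates_def
proof (intro ballI)
  interpret prob_space M by fact
  fix A and B :: "'b set" assume A: "A \<in> sets (past M X n)" and B: "B \<in> sets borel"
  have AM[measurable]: "A \<in> sets M" using A subalgebra_past[of X M n, OF X] unfolding subalgebra_def by auto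
  note X[measurable]
  define \<nu> where "\<nu> m = distr (density M (indicator A)) borel (X m)" for m
  have em\<nu>: "emeasure (\<nu> m) B = emeasure M (A \<inter> X m -` B)" if [measurable]: "B \<in> sets borel" for m B
  proof -
    have "emeasure (\<nu> m) B = emeasure (density M (indicator A)) (X m -` B \<inter> space M)"
      unfolding \<nu>_def by (subst emeasure_distr) auto
    also have "\<dots> = (\<integral>\<^sup>+\<omega>. indicator A \<omega> * indicator (X m -` B \<inter> space M) \<omega> \<partial>M)"
      by (intro emeasure_density) measurable
    also have "\<dots> = (\<integral>\<^sup>+\<omega>. indicator (A \<inter> X m -` B) \<omega> \<partial>M)"
      by (intro nn_integral_cong) (auto simp: indicator_def)
    also have "A \<inter> X m -` B = A \<inter> (X m -` B \<inter> space M)" using sets.sets_into_space[OF AM] by auto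
    then have "(\<integral>\<^sup>+\<omega>. indicator (A \<inter> X m -` B) \<omega> \<partial>M) = emeasure M (A \<inter> X m -` B)"
      by simp
    finally show ?thesis .
  qed
  have \<nu>_eq: "\<nu> m = \<nu> n" if "n \<le> m" for m
  proof (rule measure_eqI)
    show "sets (\<nu> m) = sets (\<nu> n)" by (simp add: \<nu>_def)
    fix B assume "B \<in> sets (\<nu> m)"
    then have "B \<in> sets borel" by (simp add: \<nu>_def)
    then show "emeasure (\<nu> m) B = emeasure (\<nu> n) B"
      using cid_past_swap[OF X cid A _ that] by (simp add: em\<nu>)
  qed
  have cont: "(\<integral>\<^sup>+x. ennreal (f x) \<partial>\<nu> n) = (\<integral>\<^sup>+\<omega>. indicator A \<omega> * ennreal (\<integral>x. f x \<partial>\<alpha> \<omega>) \<partial>M)"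
    if f: "continuous_on UNIV f" "\<And>x. 0 \<le> f x" "\<And>x. f x \<le> 1" for f :: "'b \<Rightarrow> real"
  proof -
    have fm[measurable]: "f \<in> borel_measurable borel" using f(1) by (rule borel_measurable_continuous_onI)
    have int: "integrable \<mu> f" if "prob_space \<mu>" "sets \<mu> = sets borel" for \<mu>
    proof -
      interpret \<mu>: prob_space \<mu> by fact
      have "f \<in> borel_measurable \<mu>" using fm that(2) by (simp cong: measurable_cong_sets)
      then show ?thesis using f(2,3) by (intro \<mu>.integrable_const_bound[of _ 1]) auto
    qed
    have bnd: "0 \<le> (\<integral>x. f x \<partial>\<mu>)" "(\<integral>x. f x \<partial>\<mu>) \<le> 1" if "prob_space \<mu>" "sets \<mu> = sets borel" for \<mu>
    proof -
      interpret \<mu>: prob_space \<mu> by fact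
      show "0 \<le> (\<integral>x. f x \<partial>\<mu>)" using f(2) by simp
      show "(\<integral>x. f x \<partial>\<mu>) \<le> 1" using f(3) by (intro \<mu>.integral_le_const[OF int[OF that]]) auto
    qed
    have meas_int: "(\<lambda>\<omega>. \<integral>x. f x \<partial>\<kappa> \<omega>) \<in> borel_measurable M" if "\<kappa> \<in> M \<rightarrow>\<^sub>M prob_algebra borel" for \<kappa>
      by (rule measurable_compose[OF measurable_prob_algebraD[OF that] integral_measurable_subprob_algebra[OF fm]])
    have eq: "(\<integral>\<^sup>+x. ennreal (f x) \<partial>\<nu> n) = (\<integral>\<^sup>+\<omega>. indicator A \<omega> * ennreal (\<integral>x. f x \<partial>\<alpha>n m \<omega>) \<partial>M)"
      if m: "n \<le> m" "1 \<le> m" for m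
    proof -
      have \<alpha>m: "\<alpha>n m \<in> M \<rightarrow>\<^sub>M prob_algebra borel"
        using pred m unfolding predictive_measures_def random_prob_measure_def by auto
      have sub: "subalgebra M (past M X m)" by (rule subalgebra_past[OF X])
      have [measurable]: "A \<in> sets (past M X m)" using A past_mono[OF m(1)] by auto
      \<comment> \<open>A also lies in the past at m, which makes this integrand measurable for the
        product sigma-field on which the law of (\<omega>, \<open>X m \<omega>\<close>) is
        known.\<close>
      let ?h = "\<lambda>z. indicator A (fst z) * ennreal (f (snd z))"
      have h: "?h \<in> borel_measurable (past M X m \<Otimes>\<^sub>M borel)" by measurable
      have "(\<integral>\<^sup>+x. ennreal (f x) \<partial>\<nu> n) = (\<integral>\<^sup>+x. ennreal (f x) \<partial>\<nu> m)" using \<nu>_eq[OF m(1)] by simp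
      also have "\<dots> = (\<integral>\<^sup>+\<omega>. ennreal (f (X m \<omega>)) \<partial>density M (indicator A))"
        unfolding \<nu>_def by (intro nn_integral_distr) auto
      also have "\<dots> = (\<integral>\<^sup>+\<omega>. ?h (\<omega>, X m \<omega>) \<partial>M)"
        by (subst nn_integral_density) simp_all
      also have "\<dots> = (\<integral>\<^sup>+z. ?h z \<partial>distr M (past M X m \<Otimes>\<^sub>M borel) (\<lambda>\<omega>. (\<omega>, X m \<omega>)))"
        by (rule nn_integral_distr[symmetric, OF measurable_graph_subalgebra[OF ps sub \<alpha>m X[of m]]])
          (use h in \<open>simp only: measurable_distr_eq1\<close>)
      also have "\<dots> = (\<integral>\<^sup>+z. ?h z \<partial>semidirect M (past M X m) (\<alpha>n m))"
        using disintegrates_imp_distr_eq_semidirect[OF ps sub \<alpha>m X predictive_disintegrates[OF ps X pred m(2)]] by simp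
      also have "\<dots> = (\<integral>\<^sup>+\<omega>. \<integral>\<^sup>+x. ?h (\<omega>, x) \<partial>\<alpha>n m \<omega> \<partial>M)"
        by (rule nn_integral_semidirect[OF ps sub \<alpha>m h])
      also have "\<dots> = (\<integral>\<^sup>+\<omega>. indicator A \<omega> * ennreal (\<integral>x. f x \<partial>\<alpha>n m \<omega>) \<partial>M)"
      proof (intro nn_integral_cong)
        fix \<omega> assume "\<omega> \<in> space M"
        note k = prob_kernelD[OF \<alpha>m this]
        have "(\<integral>\<^sup>+x. ennreal (f x) \<partial>\<alpha>n m \<omega>) = ennreal (\<integral>x. f x \<partial>\<alpha>n m \<omega>)"
          using f(2) by (intro nn_integral_eq_integral int k) auto
        then show "(\<integral>\<^sup>+x. ?h (\<omega>, x) \<partial>\<alpha>n m \<omega>) = indicator A \<omega> * ennreal (\<integral>x. f x \<partial>\<alpha>n m \<omega>)"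
          by (simp add: indicator_def)
      qed
      finally show ?thesis .
    qed
    \<comment> \<open>The shift to \<open>Suc m\<close> stays with the indices at which
      \<open>predictive_measures\<close> asserts measurability of the kernel.\<close>
    have "(\<lambda>m. \<integral>\<^sup>+\<omega>. indicator A \<omega> * ennreal (\<integral>x. f x \<partial>\<alpha>n (Suc m) \<omega>) \<partial>M)
      \<longlonglongrightarrow> (\<integral>\<^sup>+\<omega>. indicator A \<omega> * ennreal (\<integral>x. f x \<partial>\<alpha> \<omega>) \<partial>M)"
    proof (rule nn_integral_dominated_convergence[where w = "\<lambda>_. 1"])
      have \<alpha>m: "\<alpha>n (Suc m) \<in> M \<rightarrow>\<^sub>M prob_algebra borel" for m
        using pred unfolding predictive_measures_def random_prob_measure_def by auto
      note meas_int[OF \<alpha>m, measurable] meas_int[OF \<alpha>, measurable]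
      show "(\<lambda>\<omega>. indicator A \<omega> * ennreal (\<integral>x. f x \<partial>\<alpha>n (Suc m) \<omega>)) \<in> borel_measurable M" for m
        by measurable
      show "(\<lambda>\<omega>. indicator A \<omega> * ennreal (\<integral>x. f x \<partial>\<alpha> \<omega>)) \<in> borel_measurable M" by measurable
      show "AE \<omega> in M. indicator A \<omega> * ennreal (\<integral>x. f x \<partial>\<alpha>n (Suc m) \<omega>) \<le> 1" for m
        using bnd(2)[OF prob_kernelD(1,2)[OF \<alpha>m]] by (intro AE_I2) (auto simp: indicator_def)
      show "AE \<omega> in M. (\<lambda>m. indicator A \<omega> * ennreal (\<integral>x. f x \<partial>\<alpha>n (Suc m) \<omega>))
        \<longlonglongrightarrow> indicator A \<omega> * ennreal (\<integral>x. f x \<partial>\<alpha> \<omega>)"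
        using weak
      proof eventually_elim
        fix \<omega> assume w: "weakly_converges (\<lambda>n. \<alpha>n n \<omega>) (\<alpha> \<omega>)"
        have "bounded (range f)" using f(2,3) by (intro boundedI[of _ 1]) auto
        then have "(\<lambda>m. \<integral>x. f x \<partial>\<alpha>n m \<omega>) \<longlonglongrightarrow> (\<integral>x. f x \<partial>\<alpha> \<omega>)"
          using w f(1) unfolding weakly_converges_def by auto
        then have "(\<lambda>m. ennreal (\<integral>x. f x \<partial>\<alpha>n (Suc m) \<omega>)) \<longlonglongrightarrow> ennreal (\<integral>x. f x \<partial>\<alpha> \<omega>)"
          by (intro tendsto_ennrealI) (rule LIMSEQ_Suc)
        then show "(\<lambda>m. indicator A \<omega> * ennreal (\<integral>x. f x \<partial>\<alpha>n (Suc m) \<omega>))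
          \<longlonglongrightarrow> indicator A \<omega> * ennreal (\<integral>x. f x \<partial>\<alpha> \<omega>)"
          by (simp add: indicator_def)
      qed
    qed (auto simp: emeasure_eq_measure)
    moreover have "eventually (\<lambda>m. (\<integral>\<^sup>+\<omega>. indicator A \<omega> * ennreal (\<integral>x. f x \<partial>\<alpha>n (Suc m) \<omega>) \<partial>M)
        = (\<integral>\<^sup>+x. ennreal (f x) \<partial>\<nu> n)) sequentially"
      unfolding eventually_sequentially by (rule exI[of _ n]) (auto intro!: eq[symmetric])
    then have "(\<lambda>m. \<integral>\<^sup>+\<omega>. indicator A \<omega> * ennreal (\<integral>x. f x \<partial>\<alpha>n (Suc m) \<omega>) \<partial>M) \<longlonglongrightarrow> (\<integral>\<^sup>+x. ennreal (f x) \<partial>\<nu> n)"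
      by (rule tendsto_eventually)
    ultimately show ?thesis by (rule LIMSEQ_unique[symmetric])
  qed
  \<comment> \<open>The average of \<alpha> over A is formed as a measure, so that its equality with
    \<open>\<nu> n\<close> has to be checked on open sets only.\<close>
  define \<mu> where "\<mu> = density M (indicator A) \<bind> \<alpha>"
  have \<alpha>': "\<alpha> \<in> density M (indicator A) \<rightarrow>\<^sub>M subprob_algebra borel"
    using measurable_prob_algebraD[OF \<alpha>] by simp
  have sets\<mu>: "sets \<mu> = sets borel"
    unfolding \<mu>_def using not_empty prob_kernelD(2)[OF \<alpha>] by (intro sets_bind) auto
  have em\<mu>: "emeasure \<mu> B = (\<integral>\<^sup>+\<omega>. indicator A \<omega> * emeasure (\<alpha> \<omega>) B \<partial>M)" if "B \<in> sets borel" for B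
  proof -
    have [measurable]: "(\<lambda>\<omega>. emeasure (\<alpha> \<omega>) B) \<in> borel_measurable M"
      using measurable_emeasure_kernel[OF measurable_prob_algebraD[OF \<alpha>] that] .
    have "emeasure \<mu> B = (\<integral>\<^sup>+\<omega>. emeasure (\<alpha> \<omega>) B \<partial>density M (indicator A))"
      unfolding \<mu>_def using that not_empty by (intro emeasure_bind[OF _ \<alpha>']) auto
    also have "\<dots> = (\<integral>\<^sup>+\<omega>. indicator A \<omega> * emeasure (\<alpha> \<omega>) B \<partial>M)"
      by (intro nn_integral_density) auto
    finally show ?thesis .
  qed
  have opn: "emeasure (\<nu> n) U = emeasure \<mu> U" if U: "open U" for U
  proof -
    obtain f :: "nat \<Rightarrow> 'b \<Rightarrow> real" where f: "\<And>k. continuous_on UNIV (f k)" "\<And>k x. 0 \<le> f k x" "\<And>k x. f k x \<le> 1"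
      and lim: "\<And>x. (\<lambda>k. f k x) \<longlonglongrightarrow> indicator U x"
      by (rule open_indicator_limit[OF U]) (rule that; assumption)
    have fm[measurable]: "f k \<in> borel_measurable borel" for k using f(1) by (rule borel_measurable_continuous_onI)
    have Ub[measurable]: "U \<in> sets borel" using U by auto
    have [measurable]: "(\<lambda>\<omega>. emeasure (\<alpha> \<omega>) U) \<in> borel_measurable M"
      using measurable_emeasure_kernel[OF measurable_prob_algebraD[OF \<alpha>] Ub] .
    have [measurable]: "(\<lambda>\<omega>. \<integral>x. f k x \<partial>\<alpha> \<omega>) \<in> borel_measurable M" for k
      by (rule measurable_compose[OF measurable_prob_algebraD[OF \<alpha>] integral_measurable_subprob_algebra[OF fm]])
    have "emeasure (\<nu> n) UNIV \<noteq> \<infinity>" using em\<nu>[of UNIV] by (simp add: emeasure_eq_measure)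
    then have fin: "emeasure (\<nu> n) (space (\<nu> n)) < \<infinity>" by (simp add: \<nu>_def less_top)
    have "(\<lambda>k. \<integral>\<^sup>+x. ennreal (f k x) \<partial>\<nu> n) \<longlonglongrightarrow> (\<integral>\<^sup>+x. indicator U x \<partial>\<nu> n)"
    proof (rule nn_integral_dominated_convergence[where w = "\<lambda>_. 1"])
      show "AE x in \<nu> n. (\<lambda>k. ennreal (f k x)) \<longlonglongrightarrow> indicator U x"
      proof (rule AE_I2)
        fix x
        have "(\<lambda>k. ennreal (f k x)) \<longlonglongrightarrow> ennreal (indicator U x)" using lim by (rule tendsto_ennrealI)
        then show "(\<lambda>k. ennreal (f k x)) \<longlonglongrightarrow> indicator U x" by (simp add: ennreal_indicator)
      qed
    qed (use f fin in \<open>auto simp: \<nu>_def\<close>)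
    moreover have "(\<integral>\<^sup>+x. indicator U x \<partial>\<nu> n) = emeasure (\<nu> n) U" by (simp add: \<nu>_def)
    moreover have "(\<lambda>k. \<integral>\<^sup>+\<omega>. indicator A \<omega> * ennreal (\<integral>x. f k x \<partial>\<alpha> \<omega>) \<partial>M) \<longlonglongrightarrow> (\<integral>\<^sup>+\<omega>. indicator A \<omega> * emeasure (\<alpha> \<omega>) U \<partial>M)"
    proof (rule nn_integral_dominated_convergence[where w = "\<lambda>_. 1"])
      have *: "(\<integral>x. f k x \<partial>\<alpha> \<omega>) \<le> 1" "(\<lambda>k. \<integral>x. f k x \<partial>\<alpha> \<omega>) \<longlonglongrightarrow> measure (\<alpha> \<omega>) U" if "\<omega> \<in> space M" for k \<omega>
      proof -
        note k = prob_kernelD[OF \<alpha> that]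
        interpret \<alpha>: prob_space "\<alpha> \<omega>" by (rule k)
        have fk: "f k \<in> borel_measurable (\<alpha> \<omega>)" for k using fm k(2) by (simp cong: measurable_cong_sets)
        show "(\<integral>x. f k x \<partial>\<alpha> \<omega>) \<le> 1"
          using f(2,3) fk by (intro \<alpha>.integral_le_const \<alpha>.integrable_const_bound[of _ 1]) auto
        have "(\<lambda>k. \<integral>x. f k x \<partial>\<alpha> \<omega>) \<longlonglongrightarrow> (\<integral>x. indicator U x \<partial>\<alpha> \<omega>)"
          using f lim k fk by (intro integral_dominated_convergence[where w = "\<lambda>_. 1"]) auto
        then show "(\<lambda>k. \<integral>x. f k x \<partial>\<alpha> \<omega>) \<longlonglongrightarrow> measure (\<alpha> \<omega>) U" using k by simp
      qed
      show "AE \<omega> in M. indicator A \<omega> * ennreal (\<integral>x. f k x \<partial>\<alpha> \<omega>) \<le> 1" for k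
        using *(1) by (intro AE_I2) (auto simp: indicator_def)
      show "AE \<omega> in M. (\<lambda>k. indicator A \<omega> * ennreal (\<integral>x. f k x \<partial>\<alpha> \<omega>)) \<longlonglongrightarrow> indicator A \<omega> * emeasure (\<alpha> \<omega>) U"
      proof (rule AE_I2)
        fix \<omega> assume \<omega>: "\<omega> \<in> space M"
        have "emeasure (\<alpha> \<omega>) U = ennreal (measure (\<alpha> \<omega>) U)"
          by (rule finite_measure.emeasure_eq_measure[OF prob_space.finite_measure[OF prob_kernelD(1)[OF \<alpha> \<omega>]]])
        then show "(\<lambda>k. indicator A \<omega> * ennreal (\<integral>x. f k x \<partial>\<alpha> \<omega>)) \<longlonglongrightarrow> indicator A \<omega> * emeasure (\<alpha> \<omega>) U"
          using tendsto_ennrealI[OF *(2)[OF \<omega>]] by (simp add: indicator_def)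
      qed
    qed (auto simp: emeasure_eq_measure)
    ultimately show ?thesis
      using em\<mu>[OF Ub] cont[OF f] by (auto intro: LIMSEQ_unique)
  qed
  obtain K :: "'b set set" where K: "\<forall>C\<in>K. open C" "distance_determining K"
    using ex_countable_distance_determining by blast
  have "\<nu> n = \<mu>"
  proof (rule finite_measure_eqI_determining[OF K(2)])
    show s: "sets (\<nu> n) = sets borel" by (simp add: \<nu>_def)
    show "sets \<mu> = sets borel" by fact
    have "emeasure (\<nu> n) UNIV \<noteq> \<infinity>" using em\<nu>[of UNIV] by (simp add: emeasure_eq_measure)
    then show "finite_measure (\<nu> n)" "finite_measure \<mu>"
      using opn[of UNIV] sets_eq_imp_space_eq[OF s] sets_eq_imp_space_eq[OF sets\<mu>] by (auto intro!: finite_measureI)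
  qed (use K(1) opn in auto)
  then show "emeasure M (A \<inter> X n -` B) = (\<integral>\<^sup>+\<omega>. indicator A \<omega> * emeasure (\<alpha> \<omega>) B \<partial>M)"
    using em\<nu>[OF B, of n] em\<mu>[OF B] by simp
qed

section \<open>Absolute continuity of joint laws and of predictive measures\<close>

lemma sets_PiM_borel: "sets lam = sets borel \<Longrightarrow> sets (\<Pi>\<^sub>M i\<in>I. lam) = sets (\<Pi>\<^sub>M i\<in>I. borel)"
  by (intro sets_PiM_cong) auto

text \<open>Densities are taken over the probability space whose sigma-field is F itself, so that
  they are F-measurable in \<omega>, whereas disintegrations integrate over M. The two settings
  agree because an F-measurable function has the same integral in both.\<close>

lemma semidirect_restr_to_subalg:
  fixes \<kappa> :: "'w \<Rightarrow> 'b::topological_space measure"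
  assumes ps: "prob_space M" and sub: "subalgebra M F" and \<kappa>: "\<kappa> \<in> F \<rightarrow>\<^sub>M prob_algebra borel"
  shows "semidirect (restr_to_subalg M F) (restr_to_subalg M F) \<kappa> = semidirect M F \<kappa>"
proof (rule semidirect_eqI[symmetric])
  let ?N = "restr_to_subalg M F"
  have \<kappa>M: "\<kappa> \<in> M \<rightarrow>\<^sub>M prob_algebra borel" by (rule measurable_from_subalg[OF sub \<kappa>])
  show "prob_space ?N" by (rule prob_space_restr_to_subalg[OF sub ps])
  show "subalgebra ?N ?N" by (simp add: subalgebra_def)
  show "\<kappa> \<in> ?N \<rightarrow>\<^sub>M prob_algebra borel" by (rule measurable_in_subalg[OF sub \<kappa>])
  show "sets (semidirect M F \<kappa>) = sets (?N \<Otimes>\<^sub>M borel)"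
    unfolding sets_semidirect[OF ps sub \<kappa>M] by (intro sets_pair_measure_cong) (auto simp: sets_restr_to_subalg[OF sub])
  fix A and B :: "'b set" assume A: "A \<in> sets ?N" and B: "B \<in> sets (borel :: 'b measure)"
  then have AF: "A \<in> sets F" by (simp add: sets_restr_to_subalg[OF sub])
  have [measurable]: "(\<lambda>\<omega>. emeasure (\<kappa> \<omega>) B) \<in> borel_measurable F"
    using measurable_emeasure_kernel[OF measurable_prob_algebraD[OF \<kappa>] B] .
  show "emeasure (semidirect M F \<kappa>) (A \<times> B) = (\<integral>\<^sup>+\<omega>. indicator A \<omega> * emeasure (\<kappa> \<omega>) B \<partial>?N)"
    using AF by (subst nn_integral_subalgebra2[OF sub]) (auto simp: emeasure_semidirect_Times[OF ps sub \<kappa>M AF B])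
qed

context
  fixes lam :: "'b::topological_space measure"
  assumes lam: "sets lam = sets borel" "sigma_finite_measure lam"
begin

lemma measurable_emeasure_section:
  assumes D: "D \<in> sets (\<Pi>\<^sub>M i\<in>{..<Suc n}. borel)"
  shows "(\<lambda>x. emeasure lam {y. x(n := y) \<in> D}) \<in> borel_measurable (\<Pi>\<^sub>M i\<in>{..<n}. borel)"
proof -
  interpret sigma_finite_measure lam by (rule lam)
  have spl: "space lam = UNIV" using sets_eq_imp_space_eq[OF lam(1)] by simp
  let ?P = "(\<Pi>\<^sub>M i\<in>{..<n}. (borel :: 'b measure)) \<Otimes>\<^sub>M lam"
  have sP: "sets ?P = sets ((\<Pi>\<^sub>M i\<in>{..<n}. (borel :: 'b measure)) \<Otimes>\<^sub>M borel)"
    using lam by (intro sets_pair_measure_cong) auto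
  have "(\<lambda>(f, y). f(n := y)) \<in> ((\<Pi>\<^sub>M i\<in>{..<n}. (borel :: 'b measure)) \<Otimes>\<^sub>M borel) \<rightarrow>\<^sub>M (\<Pi>\<^sub>M i\<in>{..<Suc n}. borel)"
    using measurable_add_dim[of n "{..<n}" "\<lambda>_. borel :: 'b measure"] by (simp add: lessThan_Suc)
  then have "(\<lambda>(f, y). f(n := y)) \<in> ?P \<rightarrow>\<^sub>M (\<Pi>\<^sub>M i\<in>{..<Suc n}. borel)"
    using measurable_cong_sets[OF sP refl] by blast
  from measurable_sets[OF this D]
  have S: "(\<lambda>(f, y). f(n := y)) -` D \<inter> space ?P \<in> sets ?P" .
  have "Pair x -` ((\<lambda>(f, y). f(n := y)) -` D \<inter> space ?P) = {y. x(n := y) \<in> D}"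
    if "x \<in> space (\<Pi>\<^sub>M i\<in>{..<n}. (borel :: 'b measure))" for x
    using that spl by (auto simp: space_pair_measure)
  with measurable_emeasure_Pair[OF S] show ?thesis
    by (simp cong: measurable_cong)
qed

text \<open>Tonelli in the last coordinate: the product measure of D is the integral of its section
  measures, and a nonnegative function with integral 0 vanishes almost everywhere.\<close>

lemma null_sets_PiM_Suc:
  assumes D: "D \<in> sets (\<Pi>\<^sub>M i\<in>{..<Suc n}. borel)"
  shows "D \<in> null_sets (\<Pi>\<^sub>M i\<in>{..<Suc n}. lam) \<longleftrightarrow>
    (AE x in \<Pi>\<^sub>M i\<in>{..<n}. lam. emeasure lam {y. x(n := y) \<in> D} = 0)"
proof -
  interpret sigma_finite_measure lam by (rule lam)
  interpret product_sigma_finite "\<lambda>_::nat. lam" by standard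
  have spl: "space lam = UNIV" using sets_eq_imp_space_eq[OF lam(1)] by simp
  have D': "D \<in> sets (\<Pi>\<^sub>M i\<in>insert n {..<n}. lam)" using D sets_PiM_borel[OF lam(1), of "insert n {..<n}"] by (simp add: lessThan_Suc)
  have "emeasure (\<Pi>\<^sub>M i\<in>{..<Suc n}. lam) D = (\<integral>\<^sup>+z. indicator D z \<partial>(\<Pi>\<^sub>M i\<in>insert n {..<n}. lam))"
    using D' by (simp add: lessThan_Suc)
  also have "\<dots> = (\<integral>\<^sup>+x. \<integral>\<^sup>+y. indicator D (x(n := y)) \<partial>lam \<partial>(\<Pi>\<^sub>M i\<in>{..<n}. lam))"
    using D' by (intro product_nn_integral_insert) auto
  also have "\<dots> = (\<integral>\<^sup>+x. emeasure lam {y. x(n := y) \<in> D} \<partial>(\<Pi>\<^sub>M i\<in>{..<n}. lam))"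
  proof (intro nn_integral_cong)
    fix x assume x: "x \<in> space (\<Pi>\<^sub>M i\<in>{..<n}. lam)"
    have "(\<lambda>y. x(n := y)) -` D \<inter> space lam \<in> sets lam"
      using measurable_sets[OF measurable_component_update[OF x] D'] by simp
    then have "{y. x(n := y) \<in> D} \<in> sets lam" by (simp add: spl vimage_def)
    moreover have "(\<integral>\<^sup>+y. indicator D (x(n := y)) \<partial>lam) = (\<integral>\<^sup>+y. indicator {y. x(n := y) \<in> D} y \<partial>lam)"
      by (intro nn_integral_cong) (auto simp: indicator_def)
    ultimately show "(\<integral>\<^sup>+y. indicator D (x(n := y)) \<partial>lam) = emeasure lam {y. x(n := y) \<in> D}" by simp
  qed
  finally have eq: "emeasure (\<Pi>\<^sub>M i\<in>{..<Suc n}. lam) D = (\<integral>\<^sup>+x. emeasure lam {y. x(n := y) \<in> D} \<partial>(\<Pi>\<^sub>M i\<in>{..<n}. lam))" .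
  have "(\<lambda>x. emeasure lam {y. x(n := y) \<in> D}) \<in> borel_measurable (\<Pi>\<^sub>M i\<in>{..<n}. lam)"
    using measurable_emeasure_section[OF D] measurable_cong_sets[OF sets_PiM_borel[OF lam(1)] refl] by blast
  then show ?thesis
    using D' by (simp add: null_sets_def eq nn_integral_0_iff_AE flip: lessThan_Suc)
qed

context
  fixes M :: "'w measure" and X :: "nat \<Rightarrow> 'w \<Rightarrow> 'b"
  assumes ps: "prob_space M" and X: "\<And>i. X i \<in> M \<rightarrow>\<^sub>M borel"
begin

text \<open>Almost every section of a null set D is \<lambda>-null for the product measure, hence by
  the induction hypothesis also for the law of the first n observations. The section at the observed
  vector is then a random \<lambda>-null set, and the probability that the next observation falls
  into it is the mean of its \<alpha>-measure, which is 0.\<close>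

lemma joint_law_absolutely_continuous:
  assumes dis: "\<And>n. disintegrates M (past M X n) (X n) \<alpha>" and \<alpha>: "\<alpha> \<in> M \<rightarrow>\<^sub>M prob_algebra borel"
    and ac: "AE \<omega> in M. absolutely_continuous lam (\<alpha> \<omega>)"
  shows "absolutely_continuous (\<Pi>\<^sub>M i\<in>{..<n}. lam) (joint_law M X n)"
proof (induction n)
  case 0
  show ?case unfolding absolutely_continuous_def
  proof
    fix D :: "(nat \<Rightarrow> 'b) set" assume "D \<in> null_sets (\<Pi>\<^sub>M i\<in>{..<0}. lam)"
    \<comment> \<open>The empty product is counting measure on a single point, whose only null set
      is empty.\<close>
    then have "D = {}" by (auto simp: PiM_empty null_sets_count_space)
    then show "D \<in> null_sets (joint_law M X 0)" by simp
  qed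
next
  case (Suc n)
  interpret prob_space M by (rule ps)
  note sub = subalgebra_past[of X M n, OF X]
  note sd = ps sub \<alpha>
  show ?case unfolding absolutely_continuous_def
  proof
    fix D assume Dn: "D \<in> null_sets (\<Pi>\<^sub>M i\<in>{..<Suc n}. lam)"
    then have D: "D \<in> sets (\<Pi>\<^sub>M i\<in>{..<Suc n}. borel)"
      using sets_PiM_borel[OF lam(1), of "{..<Suc n}"] by auto
    have "AE x in \<Pi>\<^sub>M i\<in>{..<n}. lam. emeasure lam {y. x(n := y) \<in> D} = 0"
      using null_sets_PiM_Suc[OF D] Dn by simp
    then have "AE x in joint_law M X n. emeasure lam {y. x(n := y) \<in> D} = 0"
      by (intro absolutely_continuous_AE[OF _ Suc]) (simp_all add: joint_law_def sets_PiM_borel[OF lam(1)])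
    then have obs0: "AE \<omega> in M. emeasure lam {y. (obs X n \<omega>)(n := y) \<in> D} = 0"
      unfolding joint_law_obs by (rule AE_distrD[OF obs_measurable[OF X]])
    define C where "C = {z \<in> space M \<times> UNIV. (obs X n (fst z))(n := snd z) \<in> D}"
    have obsm: "(\<lambda>z. (obs X n (fst z), snd z)) \<in> (past M X n \<Otimes>\<^sub>M borel) \<rightarrow>\<^sub>M ((\<Pi>\<^sub>M i\<in>{..<n}. borel) \<Otimes>\<^sub>M borel)"
      by (intro measurable_Pair measurable_compose[OF measurable_fst obs_measurable_past] measurable_snd)
    have add: "(\<lambda>(f, y). f(n := y)) \<in> ((\<Pi>\<^sub>M i\<in>{..<n}. (borel :: 'b measure)) \<Otimes>\<^sub>M borel) \<rightarrow>\<^sub>M (\<Pi>\<^sub>M i\<in>{..<Suc n}. borel)"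
      using measurable_add_dim[of n "{..<n}" "\<lambda>_. borel :: 'b measure"] by (simp add: lessThan_Suc)
    have C: "C \<in> sets (past M X n \<Otimes>\<^sub>M borel)"
    proof -
      have "C = (\<lambda>z. (\<lambda>(f, y). f(n := y)) (obs X n (fst z), snd z)) -` D \<inter> space (past M X n \<Otimes>\<^sub>M borel)"
        unfolding C_def by (auto simp: space_pair_measure space_past)
      also have "\<dots> \<in> sets (past M X n \<Otimes>\<^sub>M borel)"
        by (rule measurable_sets[OF measurable_compose[OF obsm add] D])
      finally show ?thesis .
    qed
    have "emeasure (joint_law M X (Suc n)) D = emeasure M (obs X (Suc n) -` D \<inter> space M)"
      unfolding joint_law_obs by (rule emeasure_distr[OF obs_measurable[OF X] D])
    also have "obs X (Suc n) -` D \<inter> space M = (\<lambda>\<omega>. (\<omega>, X n \<omega>)) -` C \<inter> space M"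
      unfolding C_def by (auto simp: obs_Suc)
    also have "emeasure M \<dots> = emeasure (distr M (past M X n \<Otimes>\<^sub>M borel) (\<lambda>\<omega>. (\<omega>, X n \<omega>))) C"
      by (rule emeasure_distr[symmetric, OF measurable_graph_subalgebra[OF sd X] C])
    also have "\<dots> = (\<integral>\<^sup>+\<omega>. emeasure (\<alpha> \<omega>) (Pair \<omega> -` C) \<partial>M)"
      unfolding disintegrates_imp_distr_eq_semidirect[OF sd X dis] by (rule emeasure_semidirect[OF sd C])
    also have "\<dots> = (\<integral>\<^sup>+\<omega>. 0 \<partial>M)"
    proof (rule nn_integral_cong_AE)
      show "AE \<omega> in M. emeasure (\<alpha> \<omega>) (Pair \<omega> -` C) = 0"
        using obs0 ac AE_space
      proof eventually_elim
        fix \<omega> assume *: "emeasure lam {y. (obs X n \<omega>)(n := y) \<in> D} = 0" "absolutely_continuous lam (\<alpha> \<omega>)" "\<omega> \<in> space M"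
        have eq: "Pair \<omega> -` C = {y. (obs X n \<omega>)(n := y) \<in> D}" using *(3) unfolding C_def by auto
        have "Pair \<omega> -` C \<in> sets lam" using sets_Pair1[OF C] lam(1) by simp
        then have "Pair \<omega> -` C \<in> null_sets lam" using *(1) eq by auto
        then show "emeasure (\<alpha> \<omega>) (Pair \<omega> -` C) = 0"
          using *(2) unfolding absolutely_continuous_def by auto
      qed
    qed
    finally show "D \<in> null_sets (joint_law M X (Suc n))"
      using D by (simp add: null_sets_def joint_law_def)
  qed
qed

text \<open>The section of a null set C at \<omega> is the section of one set D of n + 1 coordinates
  at the observed vector. The semidirect mass of C is the probability that the first n + 1
  observations lie in D, so absolute continuity of the joint law applies after D has been reduced to
  a null set.\<close>

lemma absolutely_continuous_semidirect_past:
  assumes dis: "disintegrates M (past M X n) (X n) \<kappa>" and \<kappa>: "\<kappa> \<in> past M X n \<rightarrow>\<^sub>M prob_algebra borel"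
    and ac: "absolutely_continuous (\<Pi>\<^sub>M i\<in>{..<Suc n}. lam) (joint_law M X (Suc n))"
  defines "N \<equiv> restr_to_subalg M (past M X n)"
  shows "absolutely_continuous (N \<Otimes>\<^sub>M lam) (semidirect N N \<kappa>)"
  unfolding absolutely_continuous_def
proof
  interpret prob_space M by (rule ps)
  interpret lam: sigma_finite_measure lam by (rule lam)
  note sub = subalgebra_past[of X M n, OF X]
  have \<kappa>M: "\<kappa> \<in> M \<rightarrow>\<^sub>M prob_algebra borel" by (rule measurable_from_subalg[OF sub \<kappa>])
  note sd = ps sub \<kappa>M
  fix C assume C0: "C \<in> null_sets (N \<Otimes>\<^sub>M lam)"
  have setsN: "sets (N \<Otimes>\<^sub>M lam) = sets (past M X n \<Otimes>\<^sub>M borel)"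
    unfolding N_def using lam(1) by (intro sets_pair_measure_cong) (auto simp: sets_restr_to_subalg[OF sub])
  then have C: "C \<in> sets (past M X n \<Otimes>\<^sub>M borel)" using C0 by auto
  obtain D where D: "D \<in> sets (\<Pi>\<^sub>M i\<in>{..<Suc n}. borel)"
    and C_eq: "C = {z \<in> space M \<times> UNIV. (obs X n (fst z))(n := snd z) \<in> D}"
    using sets_past_pair_obs[OF C] .
  let ?s = "\<lambda>x. emeasure lam {y. x(n := y) \<in> D}"
  let ?P = "\<Pi>\<^sub>M i\<in>{..<n}. (borel :: 'b measure)"
  have "(\<integral>\<^sup>+\<omega>. emeasure lam (Pair \<omega> -` C) \<partial>N) = 0"
    using lam.emeasure_pair_measure_alt[OF null_setsD2[OF C0]] null_setsD1[OF C0] by simp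
  then have "AE \<omega> in N. emeasure lam (Pair \<omega> -` C) = 0"
    using lam.measurable_emeasure_Pair[OF null_setsD2[OF C0]] by (subst (asm) nn_integral_0_iff_AE) auto
  then have "AE \<omega> in M. emeasure lam (Pair \<omega> -` C) = 0"
    unfolding N_def by (rule AE_restr_to_subalg[OF sub])
  then have sec: "AE \<omega> in M. ?s (obs X n \<omega>) = 0"
    using AE_space
  proof eventually_elim
    fix \<omega> assume "emeasure lam (Pair \<omega> -` C) = 0" "\<omega> \<in> space M"
    moreover from this have "Pair \<omega> -` C = {y. (obs X n \<omega>)(n := y) \<in> D}" unfolding C_eq by auto
    ultimately show "?s (obs X n \<omega>) = 0" by simp
  qed
  \<comment> \<open>\<open>D\<close> itself need not be null for the product measure: only \<open>joint_law M X n\<close>-almost all of its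
    sections are. Discarding the other sections does not change the event almost surely.\<close>
  define D' where "D' = {z \<in> space (\<Pi>\<^sub>M i\<in>{..<Suc n}. (borel :: 'b measure)). z \<in> D \<and> ?s (restrict z {..<n}) = 0}"
  have D': "D' \<in> sets (\<Pi>\<^sub>M i\<in>{..<Suc n}. borel)"
  proof -
    have [measurable]: "(\<lambda>z. ?s (restrict z {..<n})) \<in> borel_measurable (\<Pi>\<^sub>M i\<in>{..<Suc n}. borel)"
      by (rule measurable_compose[OF measurable_restrict_subset measurable_emeasure_section[OF D]]) auto
    note D[measurable]
    show ?thesis unfolding D'_def by measurable
  qed
  have "D' \<in> null_sets (\<Pi>\<^sub>M i\<in>{..<Suc n}. lam)"
    unfolding null_sets_PiM_Suc[OF D']
  proof (rule AE_I2)
    fix x assume "x \<in> space (\<Pi>\<^sub>M i\<in>{..<n}. lam)"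
    then have r: "restrict (x(n := y)) {..<n} = x" for y
      by (auto simp: space_PiM PiE_def extensional_def restrict_def)
    have mem: "x(n := y) \<in> D' \<longleftrightarrow> x(n := y) \<in> D \<and> ?s x = 0" for y
      using sets.sets_into_space[OF D] unfolding D'_def mem_Collect_eq r by blast
    show "emeasure lam {y. x(n := y) \<in> D'} = 0"
    proof (cases "?s x = 0")
      case True
      then have "{y. x(n := y) \<in> D'} = {y. x(n := y) \<in> D}"
        unfolding mem by simp
      with True show ?thesis by simp
    next
      case False
      then have "{y. x(n := y) \<in> D'} = {}" unfolding mem by simp
      then show ?thesis by simp
    qed
  qed
  then have "D' \<in> null_sets (joint_law M X (Suc n))" using ac unfolding absolutely_continuous_def by auto
  then have "emeasure M (obs X (Suc n) -` D' \<inter> space M) = 0"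
    unfolding joint_law_obs using emeasure_distr[OF obs_measurable[OF X] D'] by auto
  then have "AE \<omega> in M. \<omega> \<notin> obs X (Suc n) -` D' \<inter> space M"
    using measurable_sets[OF obs_measurable[OF X] D'] by (intro AE_not_in) (auto simp: null_sets_def)
  with sec AE_space have "AE \<omega> in M. (\<omega>, X n \<omega>) \<notin> C"
  proof eventually_elim
    fix \<omega> assume *: "?s (obs X n \<omega>) = 0" "\<omega> \<in> space M" "\<omega> \<notin> obs X (Suc n) -` D' \<inter> space M"
    have "obs X (Suc n) \<omega> \<notin> D"
      using * sets.sets_into_space[OF D]
      unfolding D'_def vimage_def mem_Collect_eq Int_iff restrict_obs[OF le_SucI[OF order_refl]] by blast
    then show "(\<omega>, X n \<omega>) \<notin> C" unfolding C_eq by (simp add: obs_Suc)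
  qed
  then have "emeasure M ((\<lambda>\<omega>. (\<omega>, X n \<omega>)) -` C \<inter> space M) = 0"
    using AE_iff_null_sets[OF measurable_sets[OF measurable_graph_subalgebra[OF sd X[of n]] C]] by auto
  then have "emeasure (distr M (past M X n \<Otimes>\<^sub>M borel) (\<lambda>\<omega>. (\<omega>, X n \<omega>))) C = 0"
    using emeasure_distr[OF measurable_graph_subalgebra[OF sd X] C] by simp
  then have "emeasure (semidirect M (past M X n) \<kappa>) C = 0"
    unfolding disintegrates_imp_distr_eq_semidirect[OF sd X dis] .
  then show "C \<in> null_sets (semidirect N N \<kappa>)"
    unfolding N_def semidirect_restr_to_subalg[OF ps sub \<kappa>] using C sets_semidirect[OF sd] by (simp add: null_sets_def)
qed

end

end

lemma predictive_absolutely_continuous: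
  fixes X :: "nat \<Rightarrow> 'w \<Rightarrow> 'b::polish_space"
  assumes lam: "sets lam = sets borel" "sigma_finite_measure lam"
    and ps: "prob_space M" and X: "\<And>i. X i \<in> M \<rightarrow>\<^sub>M borel"
    and pred: "predictive_measures M X \<alpha>n" and n: "n \<ge> 1"
    and ac: "absolutely_continuous (\<Pi>\<^sub>M i\<in>{..<Suc n}. lam) (joint_law M X (Suc n))"
  shows "AE \<omega> in M. absolutely_continuous lam (\<alpha>n n \<omega>)"
proof -
  interpret lam: sigma_finite_measure lam by (rule lam)
  note sub = subalgebra_past[of X M n, OF X]
  have \<alpha>: "\<alpha>n n \<in> M \<rightarrow>\<^sub>M prob_algebra borel"
    using pred n unfolding predictive_measures_def random_prob_measure_def by auto
  \<comment> \<open>Random probability measures are only M-measurable by definition. Measurability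
    for the past comes from \<open>cond_prob_version\<close>, one Borel set at a time.\<close>
  have \<kappa>: "\<alpha>n n \<in> past M X n \<rightarrow>\<^sub>M prob_algebra borel"
  proof (intro measurable_prob_algebraI measurable_subprob_algebra)
    fix \<omega> assume "\<omega> \<in> space (past M X n)"
    then have \<omega>: "\<omega> \<in> space M" by (simp add: space_past)
    show "prob_space (\<alpha>n n \<omega>)" "sets (\<alpha>n n \<omega>) = sets borel" by (rule prob_kernelD[OF \<alpha> \<omega>])+
    then show "subprob_space (\<alpha>n n \<omega>)" by (intro prob_space_imp_subprob_space)
  next
    fix B :: "'b set" assume "B \<in> sets borel"
    then have "(\<lambda>\<omega>. measure (\<alpha>n n \<omega>) B) \<in> borel_measurable (past M X n)"
      using pred n unfolding predictive_measures_def cond_prob_version_def by auto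
    then have "(\<lambda>\<omega>. ennreal (measure (\<alpha>n n \<omega>) B)) \<in> borel_measurable (past M X n)" by measurable
    moreover have "emeasure (\<alpha>n n \<omega>) B = ennreal (measure (\<alpha>n n \<omega>) B)" if "\<omega> \<in> space (past M X n)" for \<omega>
      using that prob_kernelD(1)[OF \<alpha>] by (intro finite_measure.emeasure_eq_measure prob_space.finite_measure) (simp add: space_past)
    ultimately show "(\<lambda>\<omega>. emeasure (\<alpha>n n \<omega>) B) \<in> borel_measurable (past M X n)"
      by (simp cong: measurable_cong)
  qed
  let ?N = "restr_to_subalg M (past M X n)"
  obtain g where g: "g \<in> borel_measurable (?N \<Otimes>\<^sub>M lam)" "AE \<omega> in ?N. \<alpha>n n \<omega> = density lam (\<lambda>x. g (\<omega>, x))"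
    using kernel_density[OF prob_space_restr_to_subalg[OF sub ps] measurable_in_subalg[OF sub \<kappa>] lam
      absolutely_continuous_semidirect_past[OF lam ps X predictive_disintegrates[OF ps X pred n] \<kappa> ac]] .
  have "AE \<omega> in M. \<alpha>n n \<omega> = density lam (\<lambda>x. g (\<omega>, x))" by (rule AE_restr_to_subalg[OF sub g(2)])
  then show ?thesis using AE_space
  proof eventually_elim
    fix \<omega> assume *: "\<alpha>n n \<omega> = density lam (\<lambda>x. g (\<omega>, x))" "\<omega> \<in> space M"
    have "(\<lambda>x. g (\<omega>, x)) \<in> borel_measurable lam"
      using *(2) by (intro measurable_compose[OF measurable_Pair1' g(1)]) (simp add: space_restr_to_subalg)
    then show "absolutely_continuous lam (\<alpha>n n \<omega>)"
      unfolding *(1) by (rule absolutely_continuousI_density)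
  qed
qed

section \<open>Tools for the total variation limit\<close>

text \<open>A strictly positive integrable density leaves the null sets unchanged. Finiteness is
  wanted because the approximation in mean takes place on a finite product measure. The direction
  recorded is the one that carries absolute continuity of \<alpha> over to the new reference
  measure.\<close>

lemma ex_finite_equivalent_measure:
  assumes "sigma_finite_measure lam"
  obtains lam' where "sets lam' = sets lam" "finite_measure lam'" "absolutely_continuous lam' lam"
proof -
  interpret sigma_finite_measure lam by fact
  obtain h where h: "h \<in> borel_measurable lam" "integral\<^sup>N lam h \<noteq> \<infinity>" "\<And>x. x \<in> space lam \<Longrightarrow> 0 < h x \<and> h x < \<infinity>"
    using Ex_finite_integrable_function by blast
  have "emeasure (density lam h) (space lam) = integral\<^sup>N lam h"
    using h(1) by (simp add: emeasure_density cong: nn_integral_cong)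
  then have "finite_measure (density lam h)" using h(2) by (intro finite_measureI) simp
  moreover have "absolutely_continuous (density lam h) lam"
    unfolding absolutely_continuous_def
  proof
    fix A assume "A \<in> null_sets (density lam h)"
    then have A: "A \<in> sets lam" "AE x in lam. x \<in> A \<longrightarrow> h x = 0"
      using null_sets_density_iff[OF h(1)] by auto
    from A(2) AE_space have "AE x in lam. x \<notin> A"
      by eventually_elim (use h(3) in force)
    then show "A \<in> null_sets lam" using AE_iff_null_sets[OF A(1)] by simp
  qed
  ultimately show ?thesis using that[of "density lam h"] by simp
qed

lemma tv_dist_le:
  assumes "\<And>B. B \<in> sets borel \<Longrightarrow> \<bar>measure \<mu> B - measure \<nu> B\<bar> \<le> r"
  shows "tv_dist \<mu> \<nu> \<le> r"
  unfolding tv_dist_def by (rule cSUP_least) (use assms in auto)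

lemma measure_diff_le_tv_dist:
  assumes "prob_space \<mu>" "prob_space \<nu>" "B \<in> sets borel"
  shows "\<bar>measure \<mu> B - measure \<nu> B\<bar> \<le> tv_dist \<mu> \<nu>"
proof -
  have "\<bar>measure \<mu> C - measure \<nu> C\<bar> \<le> 1" for C
    using prob_space.prob_le_1[OF assms(1), of C] prob_space.prob_le_1[OF assms(2), of C]
      measure_nonneg[of \<mu> C] measure_nonneg[of \<nu> C] by linarith
  then have "bdd_above ((\<lambda>C. \<bar>measure \<mu> C - measure \<nu> C\<bar>) ` sets borel)" by (intro bdd_aboveI2[of _ _ 1])
  then show ?thesis unfolding tv_dist_def by (rule cSUP_upper[OF assms(3)])
qed

lemma tv_dist_nonneg: "prob_space \<mu> \<Longrightarrow> prob_space \<nu> \<Longrightarrow> 0 \<le> tv_dist \<mu> \<nu>"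
  using measure_diff_le_tv_dist[of \<mu> \<nu> "{}"] by simp

text \<open>For a fixed c, take exceptional sets of measure at most 1/(i+1). Their intersection is
  null, and a point outside it avoids some member, whose index m bounds the tail there. That m
  varies with the member does no harm, since only its existence at each point matters.\<close>

lemma AE_tendsto_zeroI:
  fixes u :: "nat \<Rightarrow> 'w \<Rightarrow> real"
  assumes fin: "finite_measure M"
    and ex: "\<And>c d. 0 < c \<Longrightarrow> 0 < d \<Longrightarrow> \<exists>S\<in>sets M. measure M S \<le> d \<and> (\<exists>m. AE \<omega> in M. \<omega> \<notin> S \<longrightarrow> (\<forall>n\<ge>m. \<bar>u n \<omega>\<bar> \<le> c))"
  shows "AE \<omega> in M. (\<lambda>n. u n \<omega>) \<longlonglongrightarrow> 0"
proof -
  interpret finite_measure M by fact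
  have ev: "AE \<omega> in M. \<exists>m. \<forall>n\<ge>m. \<bar>u n \<omega>\<bar> \<le> c" if "c > 0" for c
  proof -
    have "\<forall>i. \<exists>S m. S \<in> sets M \<and> measure M S \<le> inverse (real (Suc i)) \<and> (AE \<omega> in M. \<omega> \<notin> S \<longrightarrow> (\<forall>n\<ge>m. \<bar>u n \<omega>\<bar> \<le> c))"
    proof
      fix i
      show "\<exists>S m. S \<in> sets M \<and> measure M S \<le> inverse (real (Suc i)) \<and> (AE \<omega> in M. \<omega> \<notin> S \<longrightarrow> (\<forall>n\<ge>m. \<bar>u n \<omega>\<bar> \<le> c))"
        using ex[OF that positive_imp_inverse_positive[OF of_nat_0_less_iff[THEN iffD2, OF zero_less_Suc[of i]]]]
        by (elim bexE conjE exE) (intro exI conjI)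
    qed
    from choice[OF this] obtain S where "\<forall>i. \<exists>m. S i \<in> sets M \<and> measure M (S i) \<le> inverse (real (Suc i)) \<and>
      (AE \<omega> in M. \<omega> \<notin> S i \<longrightarrow> (\<forall>n\<ge>m. \<bar>u n \<omega>\<bar> \<le> c))" ..
    from choice[OF this] obtain m where S: "\<And>i. S i \<in> sets M" "\<And>i. measure M (S i) \<le> inverse (real (Suc i))"
      "\<And>i. AE \<omega> in M. \<omega> \<notin> S i \<longrightarrow> (\<forall>n\<ge>m i. \<bar>u n \<omega>\<bar> \<le> c)" by blast
    have I: "(\<Inter>i. S i) \<in> sets M" using S(1) by auto
    have "measure M (\<Inter>i. S i) \<le> 0"
    proof (rule LIMSEQ_le_const[OF LIMSEQ_inverse_real_of_nat], intro exI allI impI)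
      fix i
      have "measure M (\<Inter>i. S i) \<le> measure M (S i)" using S(1) by (intro finite_measure_mono) auto
      then show "measure M (\<Inter>i. S i) \<le> inverse (real (Suc i))" using S(2)[of i] by linarith
    qed
    then have "(\<Inter>i. S i) \<in> null_sets M" using I by (auto simp: null_sets_def emeasure_eq_measure measure_le_0_iff)
    then have "AE \<omega> in M. \<omega> \<notin> (\<Inter>i. S i)" by (rule AE_not_in)
    moreover have "AE \<omega> in M. \<forall>i. \<omega> \<notin> S i \<longrightarrow> (\<forall>n\<ge>m i. \<bar>u n \<omega>\<bar> \<le> c)"
      using S(3) by (simp add: AE_all_countable)
    ultimately show ?thesis by eventually_elim auto
  qed
  have "AE \<omega> in M. \<forall>j. \<exists>m. \<forall>n\<ge>m. \<bar>u n \<omega>\<bar> \<le> inverse (real (Suc j))"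
    unfolding AE_all_countable by (intro allI ev) auto
  then show ?thesis
  proof eventually_elim
    fix \<omega> assume *: "\<forall>j. \<exists>m. \<forall>n\<ge>m. \<bar>u n \<omega>\<bar> \<le> inverse (real (Suc j))"
    show "(\<lambda>n. u n \<omega>) \<longlonglongrightarrow> 0"
    proof (rule LIMSEQ_I)
      fix r :: real assume "r > 0"
      then obtain j where j: "inverse (real (Suc j)) < r" using reals_Archimedean by blast
      from * obtain m where "\<forall>n\<ge>m. \<bar>u n \<omega>\<bar> \<le> inverse (real (Suc j))" by blast
      with j have "\<forall>n\<ge>m. norm (u n \<omega> - 0) < r" by (auto intro: le_less_trans)
      then show "\<exists>no. \<forall>n\<ge>no. norm (u n \<omega> - 0) < r" by blast
    qed
  qed
qed

lemma integrable_measure_kernel: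
  assumes ps: "prob_space M" and \<kappa>: "\<kappa> \<in> M \<rightarrow>\<^sub>M prob_algebra borel" and B: "B \<in> sets borel"
  shows "integrable M (\<lambda>\<omega>. measure (\<kappa> \<omega>) B)"
proof -
  interpret prob_space M by (rule ps)
  show ?thesis
    using measurable_compose[OF \<kappa> measurable_measure_prob_algebra[OF B]]
      prob_space.prob_le_1[OF prob_kernelD(1)[OF \<kappa>]]
    by (intro integrable_const_bound[of _ 1]) auto
qed

lemma disintegrates_integral:
  assumes ps: "prob_space M" and \<kappa>: "\<kappa> \<in> M \<rightarrow>\<^sub>M prob_algebra borel"
    and dis: "disintegrates M F Z \<kappa>" and A: "A \<in> sets F" "A \<in> sets M" and B: "B \<in> sets borel"
  shows "(\<integral>\<omega>\<in>A. measure (\<kappa> \<omega>) B \<partial>M) = measure M (A \<inter> Z -` B)"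
proof -
  interpret prob_space M by (rule ps)
  have int: "integrable M (\<lambda>\<omega>. indicator A \<omega> * measure (\<kappa> \<omega>) B)"
    using integrable_mult_indicator[OF A(2) integrable_measure_kernel[OF ps \<kappa> B]] by simp
  have "ennreal (\<integral>\<omega>. indicator A \<omega> * measure (\<kappa> \<omega>) B \<partial>M) = (\<integral>\<^sup>+\<omega>. ennreal (indicator A \<omega> * measure (\<kappa> \<omega>) B) \<partial>M)"
    by (rule nn_integral_eq_integral[symmetric, OF int]) auto
  also have "\<dots> = (\<integral>\<^sup>+\<omega>. indicator A \<omega> * emeasure (\<kappa> \<omega>) B \<partial>M)"
    using finite_measure.emeasure_eq_measure[OF prob_space.finite_measure[OF prob_kernelD(1)[OF \<kappa>]]]
    by (intro nn_integral_cong) (auto simp: indicator_def)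
  also have "\<dots> = ennreal (measure M (A \<inter> Z -` B))"
    using dis A B unfolding disintegrates_def by (simp flip: emeasure_eq_measure)
  finally show ?thesis
    by (subst (asm) ennreal_inj) (auto simp: set_lebesgue_integral_def intro!: integral_nonneg_AE)
qed

text \<open>Over every A in F both kernels integrate to the probability of A with Z in B. Together
  with F-measurability of \<eta> this characterizes a conditional expectation of \<kappa>.\<close>

lemma disintegrates_cond_exp_eq:
  assumes ps: "prob_space M" and sub: "subalgebra M F"
    and \<kappa>: "\<kappa> \<in> M \<rightarrow>\<^sub>M prob_algebra borel" and \<eta>: "\<eta> \<in> M \<rightarrow>\<^sub>M prob_algebra borel"
    and dis: "disintegrates M F Z \<kappa>" "disintegrates M F Z \<eta>"
    and B: "B \<in> sets borel" and meas: "(\<lambda>\<omega>. measure (\<eta> \<omega>) B) \<in> borel_measurable F"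
  shows "AE \<omega> in M. real_cond_exp M F (\<lambda>\<omega>. measure (\<kappa> \<omega>) B) \<omega> = measure (\<eta> \<omega>) B"
proof -
  interpret prob_space M by (rule ps)
  interpret finite_measure_subalgebra M F by standard (rule sub)
  have "A \<in> sets M" if "A \<in> sets F" for A using that sub unfolding subalgebra_def by auto
  then show ?thesis
    using integrable_measure_kernel[OF ps _ B] \<kappa> \<eta> meas
    by (intro real_cond_exp_charact) (simp_all add: disintegrates_integral[OF ps \<kappa> dis(1)] disintegrates_integral[OF ps \<eta> dis(2)] B)
qed

text \<open>Conditioning fixes the F-measurable b, and monotonicity is applied to both a - b and b -
  a.\<close>

lemma real_cond_exp_diff_le:
  assumes ps: "prob_space M" and sub: "subalgebra M F"
    and int: "integrable M a" "integrable M b" "integrable M Y" and b: "b \<in> borel_measurable F"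
    and le: "AE \<omega> in M. \<bar>a \<omega> - b \<omega>\<bar> \<le> (Y \<omega> :: real)"
  shows "AE \<omega> in M. \<bar>real_cond_exp M F a \<omega> - b \<omega>\<bar> \<le> real_cond_exp M F Y \<omega>"
proof -
  interpret prob_space M by (rule ps)
  interpret finite_measure_subalgebra M F by standard (rule sub)
  have "AE \<omega> in M. real_cond_exp M F (\<lambda>\<omega>. a \<omega> - b \<omega>) \<omega> \<le> real_cond_exp M F Y \<omega>"
    using int le by (intro real_cond_exp_mono) (auto elim!: eventually_mono)
  moreover have "AE \<omega> in M. real_cond_exp M F (\<lambda>\<omega>. b \<omega> - a \<omega>) \<omega> \<le> real_cond_exp M F Y \<omega>"
    using int le by (intro real_cond_exp_mono) (auto elim!: eventually_mono)
  ultimately show ?thesis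
    using real_cond_exp_diff[OF int(1,2)] real_cond_exp_diff[OF int(2,1)] real_cond_exp_F_meas[OF int(2) b]
    by eventually_elim auto
qed

text \<open>Both projections are measurable for the sigma-field V generated by the finite stages, so
  V contains every rectangle. This supplies the generation hypothesis of
  \<open>L1_dense_filtration\<close> on the product.\<close>

lemma sets_past_infinity_pair:
  "sets (past_infinity M X \<Otimes>\<^sub>M (borel :: 'b::topological_space measure)) =
    sigma_sets (space M \<times> UNIV) (\<Union>m. sets (past M X m \<Otimes>\<^sub>M borel))" (is "sets ?P = sigma_sets ?\<Omega> ?U")
proof
  have U: "?U \<subseteq> Pow ?\<Omega>"
    using sets.sets_into_space[where M = "past M X _ \<Otimes>\<^sub>M borel"] by (auto simp: space_pair_measure space_past)
  define V where "V = sigma ?\<Omega> ?U"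
  have V: "space V = ?\<Omega>" "sets V = sigma_sets ?\<Omega> ?U"
    unfolding V_def using U by (auto simp: space_measure_of_conv sets_measure_of)
  have inV: "C \<in> sets V" if "C \<in> sets (past M X m \<Otimes>\<^sub>M borel)" for C m
    unfolding V(2) using that by (intro sigma_sets.Basic) auto
  have fst: "fst \<in> V \<rightarrow>\<^sub>M past_infinity M X"
    unfolding past_infinity_def
  proof (rule measurable_measure_of)
    show "(\<Union>n. sets (past M X n)) \<subseteq> Pow (space M)"
      using sets.sets_into_space[where M = "past M X _"] unfolding space_past by auto
    show "fst \<in> space V \<rightarrow> space M" by (auto simp: V)
    fix y assume "y \<in> (\<Union>n. sets (past M X n))"
    then obtain n where y: "y \<in> sets (past M X n)" by auto
    have "fst -` y \<inter> space V = y \<times> UNIV" using sets.sets_into_space[OF y] by (auto simp: V space_past)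
    then show "fst -` y \<inter> space V \<in> sets V" using y by (auto intro!: inV[of _ n])
  qed
  have snd: "snd \<in> V \<rightarrow>\<^sub>M (borel :: 'b measure)"
  proof (rule measurableI)
    fix B :: "'b set" assume B: "B \<in> sets borel"
    have "snd -` B \<inter> space V = space (past M X 0) \<times> B" by (auto simp: V space_past)
    then show "snd -` B \<inter> space V \<in> sets V" using B by (auto intro!: inV[of _ 0] simp del: space_past)
  qed auto
  have "sets ?P \<subseteq> sets V"
  proof (rule sets_pair_in_sets)
    fix a and b :: "'b set" assume a: "a \<in> sets (past_infinity M X)" and b: "b \<in> sets borel"
    have "(fst -` a \<inter> space V) \<inter> (snd -` b \<inter> space V) \<in> sets V"
      using measurable_sets[OF fst a] measurable_sets[OF snd b] by (rule sets.Int)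
    moreover have "(fst -` a \<inter> space V) \<inter> (snd -` b \<inter> space V) = a \<times> b"
      using sets.sets_into_space[OF a] by (auto simp: V space_past_infinity)
    ultimately show "a \<times> b \<in> sets V" by simp
  qed
  then show "sets ?P \<subseteq> sigma_sets ?\<Omega> ?U" unfolding V(2) .
  have past_sub: "sets (past M X m) \<subseteq> sets (past_infinity M X)" for m
    unfolding sets_past_infinity by (auto intro: sigma_sets.Basic)
  have "sets (past M X m \<Otimes>\<^sub>M (borel :: 'b measure)) \<subseteq> sets ?P" for m
    by (rule sets_pair_in_sets) (use past_sub in auto)
  moreover have "?\<Omega> \<in> sets ?P"
    using sets.top[of ?P] by (simp add: space_pair_measure space_past_infinity)
  ultimately show "sigma_sets ?\<Omega> ?U \<subseteq> sets ?P"
    by (intro sets.sigma_sets_subset') auto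
qed

section \<open>Convergence in total variation\<close>

lemma predictive_cond_exp:
  assumes ps: "prob_space M" and X: "\<And>i. X i \<in> M \<rightarrow>\<^sub>M borel"
    and pred: "predictive_measures M X \<alpha>n" and n: "n \<ge> 1" and \<alpha>: "\<alpha> \<in> M \<rightarrow>\<^sub>M prob_algebra borel"
    and dis: "disintegrates M (past M X n) (X n) \<alpha>" and B: "B \<in> sets borel"
  shows "AE \<omega> in M. real_cond_exp M (past M X n) (\<lambda>\<omega>. measure (\<alpha> \<omega>) B) \<omega> = measure (\<alpha>n n \<omega>) B"
proof (rule disintegrates_cond_exp_eq[OF ps subalgebra_past[OF X] \<alpha> _ dis predictive_disintegrates[OF ps X pred n] B])
  show "\<alpha>n n \<in> M \<rightarrow>\<^sub>M prob_algebra borel"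
    using pred n unfolding predictive_measures_def random_prob_measure_def by auto
  show "(\<lambda>\<omega>. measure (\<alpha>n n \<omega>) B) \<in> borel_measurable (past M X n)"
    using pred n B unfolding predictive_measures_def cond_prob_version_def by auto
qed

text \<open>The sections of a null set are \<lambda>-null for almost all \<omega>. Although they
  vary with \<omega>, each is a single set to which absolute continuity of
  \<open>\<kappa> \<omega>\<close> applies.\<close>

lemma absolutely_continuous_semidirect:
  fixes lam :: "'b::topological_space measure"
  assumes ps: "prob_space M" and sub: "subalgebra M F" and \<kappa>: "\<kappa> \<in> F \<rightarrow>\<^sub>M prob_algebra borel"
    and lam: "sets lam = sets borel" "sigma_finite_measure lam"
    and ac: "AE \<omega> in M. absolutely_continuous lam (\<kappa> \<omega>)"
  defines "N \<equiv> restr_to_subalg M F"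
  shows "absolutely_continuous (N \<Otimes>\<^sub>M lam) (semidirect N N \<kappa>)"
  unfolding absolutely_continuous_def
proof
  interpret lam: sigma_finite_measure lam by (rule lam)
  have \<kappa>M: "\<kappa> \<in> M \<rightarrow>\<^sub>M prob_algebra borel" by (rule measurable_from_subalg[OF sub \<kappa>])
  note sd = ps sub \<kappa>M
  have setsN: "sets (N \<Otimes>\<^sub>M lam) = sets (F \<Otimes>\<^sub>M borel)"
    unfolding N_def using lam(1) by (intro sets_pair_measure_cong) (auto simp: sets_restr_to_subalg[OF sub])
  fix C assume C0: "C \<in> null_sets (N \<Otimes>\<^sub>M lam)"
  then have C: "C \<in> sets (F \<Otimes>\<^sub>M borel)" using setsN by auto
  have "(\<integral>\<^sup>+\<omega>. emeasure lam (Pair \<omega> -` C) \<partial>N) = 0"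
    using lam.emeasure_pair_measure_alt[OF null_setsD2[OF C0]] null_setsD1[OF C0] by simp
  then have "AE \<omega> in N. emeasure lam (Pair \<omega> -` C) = 0"
    using lam.measurable_emeasure_Pair[OF null_setsD2[OF C0]] by (subst (asm) nn_integral_0_iff_AE) auto
  then have "AE \<omega> in M. emeasure lam (Pair \<omega> -` C) = 0"
    unfolding N_def by (rule AE_restr_to_subalg[OF sub])
  with ac have "AE \<omega> in M. emeasure (\<kappa> \<omega>) (Pair \<omega> -` C) = 0"
  proof eventually_elim
    fix \<omega> assume *: "absolutely_continuous lam (\<kappa> \<omega>)" "emeasure lam (Pair \<omega> -` C) = 0"
    have "Pair \<omega> -` C \<in> sets lam" using sets_Pair1[OF C] lam(1) by simp
    then show "emeasure (\<kappa> \<omega>) (Pair \<omega> -` C) = 0" by (rule absolutely_continuousD[OF *(1) _ *(2)])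
  qed
  then have "(\<integral>\<^sup>+\<omega>. emeasure (\<kappa> \<omega>) (Pair \<omega> -` C) \<partial>M) = (\<integral>\<^sup>+\<omega>. 0 \<partial>M)" by (rule nn_integral_cong_AE)
  then have "emeasure (semidirect M F \<kappa>) C = 0" by (simp add: emeasure_semidirect[OF sd C])
  then show "C \<in> null_sets (semidirect N N \<kappa>)"
    unfolding N_def semidirect_restr_to_subalg[OF ps sub \<kappa>] using C sets_semidirect[OF sd] by (simp add: null_sets_def)
qed

text \<open>Almost every fibre of the extended density has integral 1. This gives integrability over
  the product, and it confines the value infinity, which \<open>enn2real\<close> turns into 0, to a
  \<lambda>-null set of each such fibre.\<close>

lemma kernel_real_density:
  fixes lam :: "'b::polish_space measure"
  assumes ps: "prob_space N" and \<kappa>: "\<kappa> \<in> N \<rightarrow>\<^sub>M prob_algebra borel"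
    and lam: "sets lam = sets borel" "sigma_finite_measure lam"
    and ac: "absolutely_continuous (N \<Otimes>\<^sub>M lam) (semidirect N N \<kappa>)"
  obtains f :: "'w \<times> 'b \<Rightarrow> real" where "integrable (N \<Otimes>\<^sub>M lam) f"
    "AE \<omega> in N. \<forall>B\<in>sets borel. measure (\<kappa> \<omega>) B = (\<integral>x. indicator B x * f (\<omega>, x) \<partial>lam)"
proof -
  interpret N: prob_space N by (rule ps)
  interpret lam: sigma_finite_measure lam by (rule lam)
  have spl: "space lam = UNIV" using sets_eq_imp_space_eq[OF lam(1)] by simp
  obtain g where g[measurable]: "g \<in> borel_measurable (N \<Otimes>\<^sub>M lam)" and dens: "AE \<omega> in N. \<kappa> \<omega> = density lam (\<lambda>x. g (\<omega>, x))"
    using kernel_density[OF ps \<kappa> lam ac] .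
  have total: "(\<integral>\<^sup>+x. g (\<omega>, x) \<partial>lam) = 1" if "\<omega> \<in> space N" "\<kappa> \<omega> = density lam (\<lambda>x. g (\<omega>, x))" for \<omega>
  proof -
    have [measurable]: "(\<lambda>x. g (\<omega>, x)) \<in> borel_measurable lam" using that(1) by measurable
    have "emeasure (\<kappa> \<omega>) (space (\<kappa> \<omega>)) = 1" using prob_kernelD(1)[OF \<kappa> that(1)] by (rule prob_space.emeasure_space_1)
    then show ?thesis
      unfolding that(2) using emeasure_density[of "\<lambda>x. g (\<omega>, x)" lam "space lam"]
      by (simp add: spl sets.top[of lam, unfolded spl])
  qed
  define f where "f z = enn2real (g z)" for z
  have fm[measurable]: "f \<in> borel_measurable (N \<Otimes>\<^sub>M lam)" unfolding f_def by measurable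
  have "(\<integral>\<^sup>+z. g z \<partial>(N \<Otimes>\<^sub>M lam)) = (\<integral>\<^sup>+\<omega>. \<integral>\<^sup>+x. g (\<omega>, x) \<partial>lam \<partial>N)"
    by (rule lam.nn_integral_fst[symmetric, OF g])
  also have "\<dots> = (\<integral>\<^sup>+\<omega>. 1 \<partial>N)"
  proof (rule nn_integral_cong_AE)
    show "AE \<omega> in N. (\<integral>\<^sup>+x. g (\<omega>, x) \<partial>lam) = 1"
      using dens AE_space by eventually_elim (rule total)
  qed
  also have "\<dots> < \<infinity>" by (simp add: N.emeasure_eq_measure)
  finally have fin: "(\<integral>\<^sup>+z. g z \<partial>(N \<Otimes>\<^sub>M lam)) < \<infinity>" .
  have "(\<integral>\<^sup>+z. ennreal (norm (f z)) \<partial>(N \<Otimes>\<^sub>M lam)) \<le> (\<integral>\<^sup>+z. g z \<partial>(N \<Otimes>\<^sub>M lam))"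
    unfolding f_def by (intro nn_integral_mono) (auto simp: ennreal_enn2real_if)
  then have int: "integrable (N \<Otimes>\<^sub>M lam) f"
    using fin by (intro integrableI_bounded) auto
  have "AE \<omega> in N. \<forall>B\<in>sets borel. measure (\<kappa> \<omega>) B = (\<integral>x. indicator B x * f (\<omega>, x) \<partial>lam)"
    using dens AE_space
  proof (eventually_elim, intro ballI)
    fix \<omega> and B :: "'b set" assume *: "\<kappa> \<omega> = density lam (\<lambda>x. g (\<omega>, x))" "\<omega> \<in> space N" and B: "B \<in> sets borel"
    have Bl[measurable]: "B \<in> sets lam" using B lam by simp
    have [measurable]: "(\<lambda>x. g (\<omega>, x)) \<in> borel_measurable lam" "(\<lambda>x. f (\<omega>, x)) \<in> borel_measurable lam"
      using *(2) by measurable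
    have "AE x in lam. g (\<omega>, x) \<noteq> \<infinity>"
      using total[OF *(2,1)] by (intro nn_integral_PInf_AE) auto
    then have "(\<integral>\<^sup>+x. g (\<omega>, x) * indicator B x \<partial>lam) = (\<integral>\<^sup>+x. ennreal (indicator B x * f (\<omega>, x)) \<partial>lam)"
      by (intro nn_integral_cong_AE) (auto elim!: eventually_mono simp: f_def indicator_def less_top)
    then have "emeasure (\<kappa> \<omega>) B = (\<integral>\<^sup>+x. ennreal (indicator B x * f (\<omega>, x)) \<partial>lam)"
      unfolding *(1) by (simp add: emeasure_density)
    then show "measure (\<kappa> \<omega>) B = (\<integral>x. indicator B x * f (\<omega>, x) \<partial>lam)"
      by (subst integral_eq_nn_integral) (auto simp: measure_def f_def)
  qed
  with int that show ?thesis by blast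
qed

text \<open>The error is bounded for all large n at once outside a set of small probability. This is
  what turns an approximation in mean into almost sure convergence.\<close>

lemma tv_dist_tendsto_zero:
  fixes X :: "nat \<Rightarrow> 'w \<Rightarrow> 'b::polish_space"
  assumes ps: "prob_space M" and X: "\<And>i. X i \<in> M \<rightarrow>\<^sub>M borel"
    and pred: "predictive_measures M X \<alpha>n"
    and \<alpha>: "\<alpha> \<in> past_infinity M X \<rightarrow>\<^sub>M prob_algebra borel"
    and dis: "\<And>n. disintegrates M (past M X n) (X n) \<alpha>"
    and lam: "sets lam = sets borel" "finite_measure lam"
    and ac: "AE \<omega> in M. absolutely_continuous lam (\<alpha> \<omega>)"
  shows "AE \<omega> in M. (\<lambda>n. tv_dist (\<alpha>n n \<omega>) (\<alpha> \<omega>)) \<longlonglongrightarrow> 0"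
proof (rule AE_tendsto_zeroI)
  interpret M: prob_space M by (rule ps)
  show "finite_measure M" by unfold_locales
  interpret lam: finite_measure lam by (rule lam)
  have sflam: "sigma_finite_measure lam" by unfold_locales
  define N where "N = restr_to_subalg M (past_infinity M X)"
  note subI = subalgebra_past_infinity[of X M, OF X]
  note sub = subalgebra_past[of X M, OF X]
  interpret N: prob_space N unfolding N_def by (rule prob_space_restr_to_subalg[OF subI ps])
  interpret P: pair_sigma_finite N lam by unfold_locales
  have setsN: "sets N = sets (past_infinity M X)" "space N = space M"
    unfolding N_def by (simp_all add: sets_restr_to_subalg[OF subI] space_restr_to_subalg)
  have spl: "space lam = UNIV" using sets_eq_imp_space_eq[OF lam(1)] by simp
  have \<alpha>N: "\<alpha> \<in> N \<rightarrow>\<^sub>M prob_algebra borel" unfolding N_def by (rule measurable_in_subalg[OF subI \<alpha>])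
  have \<alpha>M: "\<alpha> \<in> M \<rightarrow>\<^sub>M prob_algebra borel" by (rule measurable_from_subalg[OF subI \<alpha>])
  have \<alpha>nM: "\<alpha>n n \<in> M \<rightarrow>\<^sub>M prob_algebra borel" if "n \<ge> 1" for n
    using pred that unfolding predictive_measures_def random_prob_measure_def by auto
  obtain f :: "'w \<times> 'b \<Rightarrow> real" where f: "integrable (N \<Otimes>\<^sub>M lam) f"
    and \<alpha>f: "AE \<omega> in N. \<forall>B\<in>sets borel. measure (\<alpha> \<omega>) B = (\<integral>x. indicator B x * f (\<omega>, x) \<partial>lam)"
    using kernel_real_density[OF N.prob_space_axioms \<alpha>N lam(1) sflam
      absolutely_continuous_semidirect[OF ps subI \<alpha> lam(1) sflam ac, folded N_def]] .
  \<comment> \<open>Starting from one observation keeps every later index at n \<ge> 1, where the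
    predictive measure is a conditional probability version. The generated sigma-field is the same
    because the stages are nested.\<close>
  define F where "F m = past M X (Suc m) \<Otimes>\<^sub>M (borel :: 'b measure)" for m
  have sets_past_N: "sets (past M X m) \<subseteq> sets N" for m
    unfolding setsN sets_past_infinity by (auto intro: sigma_sets.Basic)
  have spQ: "space (N \<Otimes>\<^sub>M lam) = space M \<times> UNIV" by (simp add: space_pair_measure setsN spl)
  have subF: "subalgebra (N \<Otimes>\<^sub>M lam) (F m)" for m
    unfolding subalgebra_def
  proof
    show "space (F m) = space (N \<Otimes>\<^sub>M lam)" unfolding spQ F_def by (simp add: space_pair_measure space_past)
    show "sets (F m) \<subseteq> sets (N \<Otimes>\<^sub>M lam)"
      unfolding F_def by (rule sets_pair_in_sets) (use sets_past_N lam(1) in auto)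
  qed
  have monoF: "sets (F m) \<subseteq> sets (F n)" if "m \<le> n" for m n
    unfolding F_def by (rule sets_pair_in_sets) (use past_mono[of "Suc m" "Suc n" M X] that in auto)
  have genF: "sets (N \<Otimes>\<^sub>M lam) = sigma_sets (space (N \<Otimes>\<^sub>M lam)) (\<Union>m. sets (F m))"
  proof -
    have "sets (past M X m \<Otimes>\<^sub>M (borel :: 'b measure)) \<subseteq> sets (F m)" for m
      unfolding F_def by (rule sets_pair_in_sets) (use past_mono[of m "Suc m" M X] in auto)
    then have "(\<Union>m. sets (past M X m \<Otimes>\<^sub>M (borel :: 'b measure))) = (\<Union>m. sets (F m))"
      unfolding F_def by blast
    moreover have "sets (N \<Otimes>\<^sub>M lam) = sets (past_infinity M X \<Otimes>\<^sub>M (borel :: 'b measure))"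
      using setsN lam(1) by (intro sets_pair_measure_cong)
    ultimately show ?thesis unfolding spQ sets_past_infinity_pair by simp
  qed
  have finQ: "finite_measure (N \<Otimes>\<^sub>M lam)"
    by (intro finite_measure_pair_measure N.finite_measure_axioms lam.finite_measure_axioms)
  obtain K :: "'b set set" where K: "countable K" "\<forall>C\<in>K. open C" "distance_determining K"
    using ex_countable_distance_determining by blast
  fix c d :: real assume c: "0 < c" and d: "0 < d"
  \<comment> \<open>The error is a sum of two terms, each allowed c/2. Each exceedance has
    probability at most the mean of Y divided by c/2, which is to be at most d/2.\<close>
  have cd: "0 < c * d / 4" using c d by simp
  obtain m h where hF: "h \<in> borel_measurable (F m)" and h: "integrable (N \<Otimes>\<^sub>M lam) h"
    and close: "(\<integral>z. \<bar>f z - h z\<bar> \<partial>(N \<Otimes>\<^sub>M lam)) < c * d / 4"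
    using L1_dense_filtration[OF finQ subF monoF genF f cd] .
  define Y where "Y \<omega> = (\<integral>x. \<bar>f (\<omega>, x) - h (\<omega>, x)\<bar> \<partial>lam)" for \<omega>
  have intfh: "integrable (N \<Otimes>\<^sub>M lam) (\<lambda>z. \<bar>f z - h z\<bar>)" using f h by auto
  have YN: "integrable N Y" unfolding Y_def using P.integrable_fst'[OF intfh] by simp
  then have YM: "integrable M Y" unfolding N_def by (rule integrable_from_subalg[OF subI])
  have Y0: "Y \<omega> \<ge> 0" for \<omega> unfolding Y_def by simp
  have EY: "(\<integral>\<omega>. Y \<omega> \<partial>M) < c * d / 4"
  proof -
    have "(\<integral>\<omega>. Y \<omega> \<partial>M) = (\<integral>\<omega>. Y \<omega> \<partial>N)"
      unfolding N_def using YN measurable_in_subalg'[OF subI, of Y] by (intro integral_subalgebra2[symmetric, OF subI]) (auto simp: N_def)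
    also have "\<dots> = (\<integral>z. \<bar>f z - h z\<bar> \<partial>(N \<Otimes>\<^sub>M lam))"
      unfolding Y_def using P.integral_fst'[OF intfh] by simp
    finally show ?thesis using close by simp
  qed
  define Z where "Z k = real_cond_exp M (past M X (Suc m + k)) Y" for k
  define S where "S = {\<omega>\<in>space M. \<exists>k. Z k \<omega> > c / 2} \<union> {\<omega>\<in>space M. Y \<omega> \<ge> c / 2}"
  have [measurable]: "Z k \<in> borel_measurable M" for k unfolding Z_def by simp
  have [measurable]: "Y \<in> borel_measurable M" using YM by auto
  have S: "S \<in> sets M" unfolding S_def by measurable
  have mS: "measure M S \<le> d"
  proof -
    have "measure M {\<omega>\<in>space M. \<exists>k. Z k \<omega> > c / 2} \<le> (\<integral>\<omega>. Y \<omega> \<partial>M) / (c / 2)"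
      unfolding Z_def using c
      by (intro conditional_expectation_maximal_inequality[OF ps sub _ YM Y0] past_mono) auto
    moreover have "measure M {\<omega>\<in>space M. Y \<omega> \<ge> c / 2} \<le> (\<integral>\<omega>. Y \<omega> \<partial>M) / (c / 2)"
      using c Y0 by (intro integral_Markov_inequality_measure[OF YM]) auto
    moreover have "measure M S \<le> measure M {\<omega>\<in>space M. \<exists>k. Z k \<omega> > c / 2} + measure M {\<omega>\<in>space M. Y \<omega> \<ge> c / 2}"
      unfolding S_def by (intro measure_Un_le) auto
    moreover have "(\<integral>\<omega>. Y \<omega> \<partial>M) / (c / 2) \<le> d / 2"
      using EY c by (simp add: field_simps)
    ultimately show ?thesis by linarith
  qed
  have AEint: "AE \<omega> in N. integrable lam (\<lambda>x. f (\<omega>, x)) \<and> integrable lam (\<lambda>x. h (\<omega>, x))"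
    using P.AE_integrable_fst'[OF f] P.AE_integrable_fst'[OF h] by eventually_elim auto
  have bound: "AE \<omega> in M. \<bar>measure (\<alpha>n (Suc m + k) \<omega>) B - measure (\<alpha> \<omega>) B\<bar> \<le> Z k \<omega> + Y \<omega>"
    if B: "B \<in> sets borel" for B k
  proof -
    have Bl[measurable]: "B \<in> sets lam" using B lam by simp
    define b where "b \<omega> = (\<integral>x. indicator B x * h (\<omega>, x) \<partial>lam)" for \<omega>
    have intB: "integrable (N \<Otimes>\<^sub>M lam) (\<lambda>z. indicator (space N \<times> B) z * h z)"
      using integrable_mult_indicator[OF _ h, of "space N \<times> B"] by simp
    have bN: "integrable N b"
    proof -
      have "integrable N (\<lambda>\<omega>. \<integral>x. indicator (space N \<times> B) (\<omega>, x) * h (\<omega>, x) \<partial>lam)"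
        using P.integrable_fst'[OF intB] .
      moreover have "(\<integral>x. indicator (space N \<times> B) (\<omega>, x) * h (\<omega>, x) \<partial>lam) = b \<omega>" if "\<omega> \<in> space N" for \<omega>
        unfolding b_def using that by (intro Bochner_Integration.integral_cong) (auto simp: indicator_def)
      ultimately show ?thesis by (simp cong: Bochner_Integration.integrable_cong)
    qed
    then have bM: "integrable M b" unfolding N_def by (rule integrable_from_subalg[OF subI])
    have bF: "b \<in> borel_measurable (past M X (Suc m))"
    proof -
      have s: "sets (past M X (Suc m) \<Otimes>\<^sub>M lam) = sets (F m)"
        unfolding F_def using lam(1) by (intro sets_pair_measure_cong) auto
      have [measurable]: "h \<in> borel_measurable (past M X (Suc m) \<Otimes>\<^sub>M lam)"
        using hF measurable_cong_sets[OF s refl] by blast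
      show ?thesis unfolding b_def by (rule lam.borel_measurable_lebesgue_integral) measurable
    qed
    have bk: "b \<in> borel_measurable (past M X (Suc m + k))"
    proof (rule measurable_from_subalg[OF _ bF])
      show "subalgebra (past M X (Suc m + k)) (past M X (Suc m))"
        using past_mono[of "Suc m" "Suc m + k" M X] by (auto simp: subalgebra_def space_past)
    qed
    have "AE \<omega> in N. \<bar>measure (\<alpha> \<omega>) B - b \<omega>\<bar> \<le> Y \<omega>"
      using \<alpha>f AEint
    proof eventually_elim
      fix \<omega> assume *: "\<forall>B\<in>sets borel. measure (\<alpha> \<omega>) B = (\<integral>x. indicator B x * f (\<omega>, x) \<partial>lam)"
        "integrable lam (\<lambda>x. f (\<omega>, x)) \<and> integrable lam (\<lambda>x. h (\<omega>, x))"
      have i: "integrable lam (\<lambda>x. indicator B x * f (\<omega>, x))" "integrable lam (\<lambda>x. indicator B x * h (\<omega>, x))"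
        using integrable_mult_indicator[OF Bl conjunct1[OF *(2)]] integrable_mult_indicator[OF Bl conjunct2[OF *(2)]]
        by simp_all
      have "measure (\<alpha> \<omega>) B - b \<omega> = (\<integral>x. indicator B x * f (\<omega>, x) - indicator B x * h (\<omega>, x) \<partial>lam)"
        unfolding b_def using * B i by simp
      also have "\<bar>\<dots>\<bar> \<le> (\<integral>x. \<bar>indicator B x * f (\<omega>, x) - indicator B x * h (\<omega>, x)\<bar> \<partial>lam)"
        by (rule integral_abs_bound)
      also have "\<dots> \<le> Y \<omega>" unfolding Y_def
        using * i by (intro integral_mono integrable_abs Bochner_Integration.integrable_diff) (auto simp: indicator_def)
      finally show "\<bar>measure (\<alpha> \<omega>) B - b \<omega>\<bar> \<le> Y \<omega>" .
    qed
    then have near: "AE \<omega> in M. \<bar>measure (\<alpha> \<omega>) B - b \<omega>\<bar> \<le> Y \<omega>"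
      unfolding N_def by (rule AE_restr_to_subalg[OF subI])
    have "AE \<omega> in M. \<bar>real_cond_exp M (past M X (Suc m + k)) (\<lambda>\<omega>. measure (\<alpha> \<omega>) B) \<omega> - b \<omega>\<bar> \<le> Z k \<omega>"
      unfolding Z_def by (rule real_cond_exp_diff_le[OF ps sub integrable_measure_kernel[OF ps \<alpha>M B] bM YM bk near])
    moreover have "AE \<omega> in M. real_cond_exp M (past M X (Suc m + k)) (\<lambda>\<omega>. measure (\<alpha> \<omega>) B) \<omega> = measure (\<alpha>n (Suc m + k) \<omega>) B"
      by (rule predictive_cond_exp[OF ps X pred _ \<alpha>M dis B]) simp
    ultimately show ?thesis using near by eventually_elim linarith
  qed
  \<comment> \<open>Only indices k and members of the countable \<open>K\<close> are quantified, so
    one null set serves them all.\<close>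
  have "AE \<omega> in M. \<forall>k. \<forall>B\<in>K. \<bar>measure (\<alpha>n (Suc m + k) \<omega>) B - measure (\<alpha> \<omega>) B\<bar> \<le> Z k \<omega> + Y \<omega>"
    unfolding AE_all_countable AE_ball_countable[OF K(1)] using K(2) by (intro allI ballI bound) auto
  then have "AE \<omega> in M. \<omega> \<notin> S \<longrightarrow> (\<forall>n\<ge>Suc m. \<bar>tv_dist (\<alpha>n n \<omega>) (\<alpha> \<omega>)\<bar> \<le> c)"
    using AE_space
  proof (eventually_elim, intro impI allI)
    fix \<omega> n assume *: "\<forall>k. \<forall>B\<in>K. \<bar>measure (\<alpha>n (Suc m + k) \<omega>) B - measure (\<alpha> \<omega>) B\<bar> \<le> Z k \<omega> + Y \<omega>"
      and \<omega>: "\<omega> \<in> space M" "\<omega> \<notin> S" and n: "Suc m \<le> n"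
    obtain k where k: "n = Suc m + k" using n le_Suc_ex by blast
    note kn = prob_kernelD[OF \<alpha>nM \<omega>(1), of n] and k\<alpha> = prob_kernelD[OF \<alpha>M \<omega>(1)]
    have n1: "n \<ge> 1" using n by simp
    have "tv_dist (\<alpha>n n \<omega>) (\<alpha> \<omega>) \<le> Z k \<omega> + Y \<omega>"
    proof (rule tv_dist_le)
      fix B :: "'b set" assume "B \<in> sets borel"
      then show "\<bar>measure (\<alpha>n n \<omega>) B - measure (\<alpha> \<omega>) B\<bar> \<le> Z k \<omega> + Y \<omega>"
        using *[rule_format, of _ k, folded k]
        by (rule distance_determiningD[OF K(3) kn(2)[OF n1] k\<alpha>(2)
          prob_space.finite_measure[OF kn(1)[OF n1]] prob_space.finite_measure[OF k\<alpha>(1)], rotated])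
    qed
    also have "\<dots> \<le> c"
    proof -
      have "\<not> Z k \<omega> > c / 2" "\<not> Y \<omega> \<ge> c / 2" using \<omega> unfolding S_def by auto
      then show ?thesis by linarith
    qed
    finally show "\<bar>tv_dist (\<alpha>n n \<omega>) (\<alpha> \<omega>)\<bar> \<le> c"
      using tv_dist_nonneg[OF kn(1)[OF n1] k\<alpha>(1)] by simp
  qed
  with S mS show "\<exists>S\<in>sets M. measure M S \<le> d \<and> (\<exists>m. AE \<omega> in M. \<omega> \<notin> S \<longrightarrow> (\<forall>n\<ge>m. \<bar>tv_dist (\<alpha>n n \<omega>) (\<alpha> \<omega>)\<bar> \<le> c))"
    by blast
qed

theorem theorem1:
  fixes M :: "'w measure"
    and lam :: "'a::polish_space measure"
    and X :: "nat \<Rightarrow> 'w \<Rightarrow> 'a"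
    and \<alpha>n :: "nat \<Rightarrow> 'w \<Rightarrow> 'a measure"
    and \<alpha> :: "'w \<Rightarrow> 'a measure"
  assumes "prob_space M"
    and "sets lam = sets borel"
    and "sigma_finite_measure lam"
    and "\<And>i. X i \<in> M \<rightarrow>\<^sub>M borel"
    and "cid M X"
    and "predictive_measures M X \<alpha>n"
    and "random_prob_measure M \<alpha>"
    and "sets (sigma_of_random_measure M \<alpha>) \<subseteq> sets (past_infinity M X)"
    and "AE \<omega> in M. weakly_converges (\<lambda>n. \<alpha>n n \<omega>) (\<alpha> \<omega>)"
  shows "(AE \<omega> in M. absolutely_continuous lam (\<alpha> \<omega>)) \<longleftrightarrow>
    (AE \<omega> in M. (\<lambda>n. tv_dist (\<alpha>n n \<omega>) (\<alpha> \<omega>)) \<longlonglongrightarrow> 0) \<and>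
    (\<forall>n\<ge>1. absolutely_continuous (\<Pi>\<^sub>M i\<in>{..<n}. lam) (joint_law M X n))"
proof -
  have \<alpha>M: "\<alpha> \<in> M \<rightarrow>\<^sub>M prob_algebra borel" using assms(7) unfolding random_prob_measure_def .
  note dis = cid_limit_disintegrates[OF assms(1,4,5,6) \<alpha>M assms(9)]
  \<comment> \<open>A map is measurable for its own \<open>vimage_algebra\<close>, hence for any
    larger sigma-field on the same space.\<close>
  have \<alpha>I: "\<alpha> \<in> past_infinity M X \<rightarrow>\<^sub>M prob_algebra borel"
  proof -
    have "\<alpha> \<in> space M \<rightarrow> space (prob_algebra borel)" using measurable_space[OF \<alpha>M] by auto
    then have "\<alpha> \<in> sigma_of_random_measure M \<alpha> \<rightarrow>\<^sub>M prob_algebra borel"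
      unfolding sigma_of_random_measure_def by (rule measurable_vimage_algebra1)
    moreover have "subalgebra (past_infinity M X) (sigma_of_random_measure M \<alpha>)"
      using assms(8) by (simp add: subalgebra_def space_past_infinity sigma_of_random_measure_def)
    ultimately show ?thesis by (rule measurable_from_subalg[rotated])
  qed
  show ?thesis
  proof (intro iffI conjI allI impI; (elim conjE)?)
    assume ac: "AE \<omega> in M. absolutely_continuous lam (\<alpha> \<omega>)"
    show "absolutely_continuous (\<Pi>\<^sub>M i\<in>{..<n}. lam) (joint_law M X n)" for n
      by (rule joint_law_absolutely_continuous[OF assms(2,3,1,4) dis \<alpha>M ac])
    \<comment> \<open>Total variation does not involve \<lambda>, so the reference measure may be
      exchanged for a finite one in this half.\<close>
    obtain lam' where lam': "sets lam' = sets lam" "finite_measure lam'" "absolutely_continuous lam' lam"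
      using ex_finite_equivalent_measure[OF assms(3)] .
    have "AE \<omega> in M. absolutely_continuous lam' (\<alpha> \<omega>)"
      using ac by eventually_elim (use lam'(3) in \<open>auto simp: absolutely_continuous_def\<close>)
    with lam'(1,2) show "AE \<omega> in M. (\<lambda>n. tv_dist (\<alpha>n n \<omega>) (\<alpha> \<omega>)) \<longlonglongrightarrow> 0"
      by (intro tv_dist_tendsto_zero[OF assms(1,4,6) \<alpha>I dis]) (auto simp: assms(2))
  next
    assume tv: "AE \<omega> in M. (\<lambda>n. tv_dist (\<alpha>n n \<omega>) (\<alpha> \<omega>)) \<longlonglongrightarrow> 0"
      and ac: "\<forall>n\<ge>1. absolutely_continuous (\<Pi>\<^sub>M i\<in>{..<n}. lam) (joint_law M X n)"
    \<comment> \<open>The predictive measure at \<open>Suc n\<close> is governed by the joint law of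
      one observation more, that is of n + 2 observations.\<close>
    have "AE \<omega> in M. \<forall>n. absolutely_continuous lam (\<alpha>n (Suc n) \<omega>)"
      unfolding AE_all_countable
      using ac by (intro allI predictive_absolutely_continuous[OF assms(2,3,1,4,6)]) auto
    with tv AE_space show "AE \<omega> in M. absolutely_continuous lam (\<alpha> \<omega>)"
    proof eventually_elim
      fix \<omega> assume tv: "(\<lambda>n. tv_dist (\<alpha>n n \<omega>) (\<alpha> \<omega>)) \<longlonglongrightarrow> 0" and \<omega>: "\<omega> \<in> space M"
        and ac: "\<forall>n. absolutely_continuous lam (\<alpha>n (Suc n) \<omega>)"
      have "\<alpha>n (Suc n) \<in> M \<rightarrow>\<^sub>M prob_algebra borel" for n
        using assms(6) unfolding predictive_measures_def random_prob_measure_def by auto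
      note kn = prob_kernelD[OF this \<omega>] and k = prob_kernelD[OF \<alpha>M \<omega>]
      show "absolutely_continuous lam (\<alpha> \<omega>)"
        unfolding absolutely_continuous_def
      proof
        fix B assume B: "B \<in> null_sets lam"
        then have Bb: "B \<in> sets borel" using assms(2) by auto
        \<comment> \<open>The predictive measures give B measure 0, so the \<alpha>-measure of B is
          itself a difference bounded by the total variation distance.\<close>
        have "\<bar>measure (\<alpha> \<omega>) B\<bar> \<le> tv_dist (\<alpha>n (Suc n) \<omega>) (\<alpha> \<omega>)" for n
        proof -
          have "measure (\<alpha>n (Suc n) \<omega>) B = 0"
            using null_setsD1[OF subsetD[OF ac[rule_format, unfolded absolutely_continuous_def] B]]
            by (simp add: measure_def)
          then show ?thesis using measure_diff_le_tv_dist[OF kn(1) k(1) Bb, of n] by simp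
        qed
        then have "\<bar>measure (\<alpha> \<omega>) B\<bar> \<le> 0"
          using LIMSEQ_le_const[OF LIMSEQ_Suc[OF tv]] by blast
        then show "B \<in> null_sets (\<alpha> \<omega>)"
          using Bb k(2) finite_measure.emeasure_eq_measure[OF prob_space.finite_measure[OF k(1)], of B]
          by (auto simp: null_sets_def measure_le_0_iff)
      qed
    qed
  qed
qed

end
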